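(* (A) Let $\{\mathfrak G_s\}_{s\in S}$ be a productable collection of AB-HO metric spaces and let $\preccurlyeq$ be a total order on $S$. Then the product ${}^{\preccurlyeq}\!\prod^*_{s\in S}\mathfrak G_s$ is a metric space if and only if the following condition is fulfilled: if $s_1$ and $s_2$ are distinct indices from $S$ with $s_1\preccurlyeq s_2$ and $a$ and $b$ are two positive real numbers that are attainable as distances in, respectively, $\mathfrak G_{s_1}$ and $\mathfrak G_{s_2}$, then $b\leq 2a$. (B) Let $\mathcal F=\{\mathfrak G_s=(X_s,d_s)\}_{s\in S}$ and $\preccurlyeq$ be a productable collection of AB-HO metric spaces and a total order on $S$ such that $\mathrm{card}(\mathrm{supp}(\mathcal F))>1$ and the GEC $\mathfrak H=(Z,\rho):={}^{\preccurlyeq}\!\prod^{\mathfrak a}_{s\in S}\mathfrak G_s$ is a metric space (where $\mathfrak a=(a_s)_{s\in S}$ is an arbitrarily fixed element of $\prod_{s\in S}X_s$). Then: (a) The topology of $\mathfrak H$ is finer than the topology inherited from the product topology of $\prod_{s\in S}X_s$. (b) For any $s\in S$, the canonical isometric map $j_s\colon X_s\to Z$ has closed image. (c) For any $s\in S$ that is not the greatest element of $\mathrm{supp}(\mathcal F)$ the space $(X_s,d_s)$ is a complete metric space with discrete topology. (d) For any $s\in S$ that is not the least element of $\mathrm{supp}(\mathcal F)$ the metric $d_s$ is bounded. (e) If $t$ is the greatest element of $\mathrm{supp}(\mathcal F)$ and $\mathfrak a'=(a_s)_{s\in S\setminus\{t\}}$, then: • the metric space $\mathfrak H'=(Z',\rho'):={}^{\preccurlyeq}\!\prod^{\mathfrak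 a'}_{s\in S\setminus\{t\}}\mathfrak G_s$ is complete and has discrete topology; • $\mathfrak H$ is naturally isometric to $\mathfrak H'\times^*\mathfrak G_t$; • the topology of $\mathfrak H'\times^*\mathfrak G_t$ coincides with the product topology of $Z'\times X_t$. In particular, $\mathfrak H$ is a complete metric space iff so is $\mathfrak G_t$. (f) If $\mathrm{supp}(\mathcal F)$ does not have the greatest element and every its countable subset is upper bounded in $\mathrm{supp}(\mathcal F)$, then $\mathfrak H$ is a complete metric space and has discrete topology. The same conclusion holds if $d_s(X_s\times X_s)\subset\{0\}\cup[\varepsilon,\infty)$ for some fixed $\varepsilon>0$ and all $s\in S$. (g) If $\mathrm{supp}(\mathcal F)$ does not have the greatest element, then $\mathfrak H$ is topologically non-discrete iff there exists a strictly increasing (with respect to $\preccurlyeq$) sequence $(t_n)_{n=1}^\infty\subset\mathrm{supp}(\mathcal F)$ that is not upper bounded in $\mathrm{supp}(\mathcal F)$ and moreover among positive reals attainable as a value of any of $d_{t_n}$ there are numbers arbitrarily close to $0$. In that case let: • $S_1:=\{s\in S: s\preccurlyeq t_1\}$; and • $S_n:=\{s\in S: t_{n-1}\preccurlyeq s\preccurlyeq t_n\}\setminus\{t_{n-1}\}$ for $n>1$; and • $\mathfrak a_n\in\prod_{s\in S_n}X_s$ for $n>0$ coincide with $\mathfrak a$ on coordinates from $S_n$; • $\mathfrak W_n=(W_n,\mu_n):={}^{\preccurlyeq}\!\prod^{\mathfrak a_n}_{s\in S_n}\mathfrak G_s$ for $n>0$. Then: • each of the spaces $\mathfrak W_n$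 is complete and has discrete topology; • $\mathfrak H$ is naturally isometric to $\mathfrak W_1\times^*\mathfrak W_2\times^*\cdots$; • the topology of $\mathfrak W_1\times^*\mathfrak W_2\times^*\cdots$ coincides with the product topology of $\prod_{n=1}^\infty W_n$; • $\mathfrak H$ is a complete metric space. In particular, $\mathfrak H$ is a complete metric space iff so are all $\mathfrak G_s$. (C) For any finite productable collection $\{\mathfrak G_k=(X_k,d_k)\}_{k=1}^r$ of AB-HO metric spaces whose product $\mathfrak G_1\times^*\cdots\times^*\mathfrak G_r$ is metric as well, the topology of $\mathfrak G_1\times^*\cdots\times^*\mathfrak G_r$ coincides with the product topology of $X_1\times\cdots\times X_r$.
   Context: A metric space is absolutely homogeneous (AB-HO) if every isometric map from a subset of it into it extends to an isometry of the space onto itself. A GEC (full graph with edge-coloring) is a pair $(V,\kappa)$ with $V$ a set and $\kappa$ a function on $V\times V$ such that $\kappa(x,y)=\kappa(z,z)\iff x=y$ and $\kappa(x,y)=\kappa(y,x)$ for all $x,y,z\in V$; every metric space $(X,d)$ is a GEC with $\kappa=d$. A collection $\mathcal F=\{\mathfrak G_s=(X_s,d_s)\}_{s\in S}$ of metric spaces is productable if $S\neq\varnothing$, all $X_s$ are non-empty, and for distinct $s_1,s_2\in S$ the sets of positive distances attained in $\mathfrak G_{s_1}$ and in $\mathfrak G_{s_2}$ are disjoint. Its support $\mathrm{supp}(\mathcal F)$ is the set of $s\in S$ such that $X_s$ has more than one point (ordered by the order of $S$). For $\mathfrak x,\mathfrak y\in\prod_{s\in S}X_s$ put $\mathrm{Diff}(\mathfrak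 x,\mathfrak y)=\{s: x_s\neq y_s\}$. For a total order $\preccurlyeq$ on $S$ and $\mathfrak a\in\prod_{s\in S}X_s$, the product ${}^{\preccurlyeq}\!\prod^{\mathfrak a}_{s\in S}\mathfrak G_s$ is the GEC $(Z,\rho)$ where $Z$ consists of all $\mathfrak x\in\prod_{s\in S}X_s$ such that $\mathrm{Diff}(\mathfrak x,\mathfrak a)$ is well-ordered by $\preccurlyeq$, $\rho(\mathfrak x,\mathfrak x)=0$, and $\rho(\mathfrak x,\mathfrak y)=d_\ell(x_\ell,y_\ell)$ for $\mathfrak x\neq\mathfrak y$, where $\ell$ is the $\preccurlyeq$-least element of $\mathrm{Diff}(\mathfrak x,\mathfrak y)$ ($\rho$ need not satisfy the triangle inequality; "the product is a metric space" means that $\rho$ is a metric). When all factors are AB-HO, its isomorphism type does not depend on $\mathfrak a$ and it is also denoted ${}^{\preccurlyeq}\!\prod^{*}_{s\in S}\mathfrak G_s$. $\mathfrak G_1\times^*\cdots\times^*\mathfrak G_r$ and $\mathfrak G_1\times^*\mathfrak G_2\times^*\cdots$ denote such products with index sets $\{1,\dots,r\}$ and $\{1,2,\ldots\}$, respectively, with the natural order (here the underlying set is the full Cartesian product); in $\mathfrak H'\times^*\mathfrak G_t$ the factor $\mathfrak H'$ comes first in the order. For $t\in S$ the canonical map $j_t\colon X_t\to Z$ sends $v$ to $(v_s)_{s\in S}$ with $v_t=v$ and $v_s=a_s$ for $s\neq t$. "Naturally isometric" refers to the obvious regrouping of coordinates. "Upper bounded in $\mathrm{supp}(\mathcal F)$"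 means having an upper bound belonging to $\mathrm{supp}(\mathcal F)$. *)

theory Defs
  imports "HOL-Analysis.Analysis"
begin

text \<open>Spaces are pairs of a carrier and a distance function, as in \<^locale>\<open>Metric_space\<close>; the
  distance function matters on the carrier only.\<close>

definition isometric_map ::
  "'a set \<Rightarrow> ('a \<Rightarrow> 'a \<Rightarrow> real) \<Rightarrow> 'b set \<Rightarrow> ('b \<Rightarrow> 'b \<Rightarrow> real) \<Rightarrow> ('a \<Rightarrow> 'b) \<Rightarrow> bool"
  where "isometric_map M d N e f \<longleftrightarrow>
    f \<in> M \<rightarrow> N \<and> (\<forall>x\<in>M. \<forall>y\<in>M. e (f x) (f y) = d x y)"

definition isometry_onto ::
  "'a set \<Rightarrow> ('a \<Rightarrow> 'a \<Rightarrow> real) \<Rightarrow> 'b set \<Rightarrow> ('b \<Rightarrow> 'b \<Rightarrow> real) \<Rightarrow> ('a \<Rightarrow> 'b) \<Rightarrow> bool"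
  where "isometry_onto M d N e f \<longleftrightarrow> isometric_map M d N e f \<and> bij_betw f M N"

definition absolutely_homogeneous :: "'a set \<Rightarrow> ('a \<Rightarrow> 'a \<Rightarrow> real) \<Rightarrow> bool"
  where "absolutely_homogeneous M d \<longleftrightarrow>
    (\<forall>A f. A \<subseteq> M \<and> isometric_map A d M d f \<longrightarrow>
       (\<exists>g. isometry_onto M d M d g \<and> (\<forall>x\<in>A. g x = f x)))"

definition complete_metric :: "'a set \<Rightarrow> ('a \<Rightarrow> 'a \<Rightarrow> real) \<Rightarrow> bool"
  where "complete_metric M d \<longleftrightarrow> Metric_space M d \<and> Metric_space.mcomplete M d"

definition topologically_discrete :: "'a set \<Rightarrow> ('a \<Rightarrow> 'a \<Rightarrow> real) \<Rightarrow> bool"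
  where "topologically_discrete M d \<longleftrightarrow> Metric_space.mtopology M d = discrete_topology M"

definition positive_distances :: "'a set \<Rightarrow> ('a \<Rightarrow> 'a \<Rightarrow> real) \<Rightarrow> real set"
  where "positive_distances M d = {c. c > 0 \<and> (\<exists>x\<in>M. \<exists>y\<in>M. d x y = c)}"

definition productable :: "'s set \<Rightarrow> ('s \<Rightarrow> 'a set) \<Rightarrow> ('s \<Rightarrow> 'a \<Rightarrow> 'a \<Rightarrow> real) \<Rightarrow> bool"
  where "productable S X d \<longleftrightarrow>
    S \<noteq> {} \<and> (\<forall>s\<in>S. Metric_space (X s) (d s) \<and> X s \<noteq> {}) \<and>
    (\<forall>s\<in>S. \<forall>t\<in>S. s \<noteq> t \<longrightarrow>
       positive_distances (X s) (d s) \<inter> positive_distances (X t) (d t) = {})"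

definition support :: "'s set \<Rightarrow> ('s \<Rightarrow> 'a set) \<Rightarrow> 's set"
  where "support S X = {s \<in> S. \<exists>x\<in>X s. \<exists>y\<in>X s. x \<noteq> y}"

definition is_least :: "'s rel \<Rightarrow> 's set \<Rightarrow> 's \<Rightarrow> bool"
  where "is_least r A l \<longleftrightarrow> l \<in> A \<and> (\<forall>s\<in>A. (l, s) \<in> r)"

definition is_greatest :: "'s rel \<Rightarrow> 's set \<Rightarrow> 's \<Rightarrow> bool"
  where "is_greatest r A g \<longleftrightarrow> g \<in> A \<and> (\<forall>s\<in>A. (s, g) \<in> r)"

definition bounded_above_in :: "'s rel \<Rightarrow> 's set \<Rightarrow> 's set \<Rightarrow> bool"
  where "bounded_above_in r B A \<longleftrightarrow> (\<exists>u\<in>B. \<forall>s\<in>A. (s, u) \<in> r)"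

definition diff_set :: "'s set \<Rightarrow> ('s \<Rightarrow> 'a) \<Rightarrow> ('s \<Rightarrow> 'a) \<Rightarrow> 's set"
  where "diff_set S x y = {s \<in> S. x s \<noteq> y s}"

text \<open>Only the restriction of the order \<open>r\<close> to \<open>S\<close> matters below, so the same \<open>r\<close> also serves for
  products over subsets of \<open>S\<close>.\<close>

definition star_set :: "'s rel \<Rightarrow> 's set \<Rightarrow> ('s \<Rightarrow> 'a set) \<Rightarrow> ('s \<Rightarrow> 'a) \<Rightarrow> ('s \<Rightarrow> 'a) set"
  where "star_set r S X a =
    {x \<in> PiE S X. well_order_on (diff_set S x a) (Restr r (diff_set S x a))}"

text \<open>Off the carrier the distance is set to 0, since \<^locale>\<open>Metric_space\<close> demands nonnegativity and
  symmetry of the distance as a total function.\<close>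

definition star_dist ::
  "'s rel \<Rightarrow> 's set \<Rightarrow> ('s \<Rightarrow> 'a set) \<Rightarrow> ('s \<Rightarrow> 'a \<Rightarrow> 'a \<Rightarrow> real) \<Rightarrow> ('s \<Rightarrow> 'a) \<Rightarrow>
    ('s \<Rightarrow> 'a) \<Rightarrow> ('s \<Rightarrow> 'a) \<Rightarrow> real"
  where "star_dist r S X d a x y =
    (if x \<in> star_set r S X a \<and> y \<in> star_set r S X a \<and> x \<noteq> y
     then let l = (THE l. is_least r (diff_set S x y) l) in d l (x l) (y l)
     else 0)"

text \<open>The product of two spaces of different types, the first one coming first in the order, is
  realized on pairs. Lemma \<open>pair_star\<close> identifies it with the product over the index set
  \<open>{1, 2}\<close>.\<close>

definition pair_star_dist ::
  "('a \<Rightarrow> 'a \<Rightarrow> real) \<Rightarrow> ('b \<Rightarrow> 'b \<Rightarrow> real) \<Rightarrow> 'a \<times> 'b \<Rightarrow> 'a \<times> 'b \<Rightarrow> real"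
  where "pair_star_dist d e = (\<lambda>(x, u) (y, v). if x \<noteq> y then d x y else e u v)"

text \<open>The blocks \<open>S\<^sub>n\<close> (for \<open>n \<ge> 1\<close>) cut out by a sequence \<open>t 1, t 2, \<dots>\<close>; the value \<open>t 0\<close> is not
  used.\<close>

definition block :: "'s rel \<Rightarrow> 's set \<Rightarrow> (nat \<Rightarrow> 's) \<Rightarrow> nat \<Rightarrow> 's set"
  where "block r S t n =
    (if n \<le> 1 then {s \<in> S. (s, t 1) \<in> r}
     else {s \<in> S. (t (n - 1), s) \<in> r \<and> (s, t n) \<in> r} - {t (n - 1)})"

lemma star_set_natLeq: "star_set natLeq S X a = PiE S X"
proof -
  have "well_order_on D (Restr natLeq D)" for D :: "nat set"
  proof -
    have "wf (Restr natLeq D - Id)"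
      by (rule wf_subset[OF wf_less]) (auto simp: natLeq_def)
    then show ?thesis
      by (auto simp: well_order_on_def linear_order_on_def partial_order_on_def preorder_on_def
          refl_on_def trans_def antisym_def total_on_def natLeq_def)
  qed
  then show ?thesis
    by (auto simp: star_set_def)
qed

lemma pair_star:
  fixes M :: "'a set" and d :: "'a \<Rightarrow> 'a \<Rightarrow> real" and N :: "'b set" and e :: "'b \<Rightarrow> 'b \<Rightarrow> real"
  defines "Y \<equiv> \<lambda>k::nat. if k = 1 then Inl ` M else Inr ` N"
    and "c \<equiv> \<lambda>k::nat. if k = 1 then (\<lambda>p q. d (projl p) (projl q)) else (\<lambda>p q. e (projr p) (projr q))"
  assumes "\<And>v. v \<in> N \<Longrightarrow> e v v = 0"
  shows "isometry_onto (M \<times> N) (pair_star_dist d e)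
    (star_set natLeq {1, 2} Y b) (star_dist natLeq {1, 2} Y c b)
    (\<lambda>(x, u). \<lambda>k\<in>{1, 2}. if k = 1 then Inl x else Inr u)"
    (is "isometry_onto _ _ _ _ ?f")
proof -
  have in_Z: "?f p \<in> star_set natLeq {1, 2} Y b" if "p \<in> M \<times> N" for p
    using that by (auto simp: star_set_natLeq Y_def PiE_iff extensional_def)
  have inj: "inj_on ?f (M \<times> N)"
  proof (rule inj_onI)
    fix p q assume "?f p = ?f q"
    from fun_cong[OF this, of 1] fun_cong[OF this, of 2] show "p = q"
      by (cases p; cases q) auto
  qed
  have surj: "z \<in> ?f ` (M \<times> N)" if "z \<in> star_set natLeq {1, 2} Y b" for z
  proof -
    have z: "z \<in> PiE {1, 2} Y"
      using that by (simp add: star_set_natLeq)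
    then have "z 1 \<in> Inl ` M" "z 2 \<in> Inr ` N"
      by (auto simp: Y_def PiE_iff)
    then obtain x u where xu: "z 1 = Inl x" "x \<in> M" "z 2 = Inr u" "u \<in> N"
      by auto
    moreover have "z = ?f (x, u)"
      using z xu by (fastforce simp: PiE_iff extensional_def)
    ultimately show ?thesis
      by blast
  qed
  have dist: "star_dist natLeq {1, 2} Y c b (?f p) (?f q) = pair_star_dist d e p q"
    if pq: "p \<in> M \<times> N" "q \<in> M \<times> N" for p q
  proof -
    obtain x u y v where xy: "p = (x, u)" "q = (y, v)"
      by (cases p; cases q)
    have Diff: "diff_set {1, 2} (?f p) (?f q) = (if x = y then {} else {1}) \<union> (if u = v then {} else {2})"
      unfolding xy diff_set_def by auto
    have least: "(THE l. is_least natLeq (diff_set {1, 2} (?f p) (?f q)) l) = (if x = y then 2 else 1)"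
      if "p \<noteq> q"
      unfolding Diff using that
      by (intro the_equality) (auto simp: xy is_least_def natLeq_def split: if_splits)
    show ?thesis
    proof (cases "p = q")
      case True
      then show ?thesis
        using pq assms(3) by (auto simp: star_dist_def pair_star_dist_def xy)
    next
      case False
      then have "?f p \<noteq> ?f q"
        using inj_onD[OF inj _ pq] by blast
      then show ?thesis
        using in_Z[OF pq(1)] in_Z[OF pq(2)] least[OF False]
        unfolding star_dist_def Let_def
        by (auto simp: pair_star_dist_def c_def xy)
    qed
  qed
  show ?thesis
    unfolding isometry_onto_def isometric_map_def bij_betw_def
    using in_Z inj surj dist by blast
qed

end

theory Submission
  imports Defs
begin

text \<open>
  Two members of the product differ from \<open>a\<close>, hence from each other, on a well-ordered set, so
  they have a first difference, and their distance is the distance of the two coordinates there.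
  Among three points, either all first differences occur at the same index, where the triangle
  inequality of the factor applies, or two of them occur at an index \<open>s\<close> and the third one later; the
  three distances are then \<open>p\<close>, \<open>p\<close>, \<open>q\<close> with \<open>p\<close> attained at \<open>s\<close> and \<open>q\<close> attained later, and the
  triangle inequality says \<open>q \<le> 2 * p\<close>.  This is (A), lemma \<open>metric_iff_spread\<close>.

  All of (B) and (C) rests on reading \<open>q \<le> 2 * p\<close> in two ways.  Fix an index \<open>s\<close>.  A distance \<open>q\<close>
  attained at \<open>s\<close> bounds all earlier distances from below by \<open>q / 2\<close>.  So two points of the product at
  distance less than \<open>q / 2\<close> agree before \<open>s\<close> and have comparable \<open>s\<close>-coordinates
  (\<open>dist_ge_half\<close>, \<open>coord_dist_le\<close>), which makes coordinates continuous; and a product over indices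
  before \<open>s\<close> is uniformly discrete, hence complete and discrete (\<open>uniformly_discrete\<close>,
  \<open>sub_product_discrete\<close>).  Conversely a distance \<open>p\<close> attained at \<open>s\<close> bounds all later distances
  from above by \<open>2 * p\<close>, so points that agree up to \<open>s\<close> are at distance at most \<open>2 * p\<close>
  (\<open>dist_le_of_agree\<close>).  When all but finitely many indices attain only small distances, closeness at
  the remaining ones suffices, which turns finitely many conditions on
  coordinates into closeness in the product (\<open>mtopology_eq_product_topology\<close>).

  Completeness of the product is equivalent to completeness of all factors (\<open>complete_star\<close>): the
  coordinatewise limit of a Cauchy sequence belongs to the product because the sequence is eventually
  constant up to any index of the support except possibly the last one.  Finally, if the support has
  no last index, then either all distances are bounded away from 0 or there is an increasing
  unbounded sequence of indices with distances tending to 0 (\<open>uniform_or_vanishing\<close>); in the second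
  case the blocks between consecutive indices of that sequence are discrete factors of a product
  indexed by \<open>{1, 2, \<dots>}\<close>.
\<close>

section \<open>Orders and first differences\<close>

text \<open>Products over subsets of the index set are formed with the same relation \<open>r\<close>, so the order
  axioms are needed for restrictions of \<open>r\<close> in a form that passes to smaller sets.\<close>

lemma linear_order_on_Restr_iff:
  "linear_order_on S (Restr r S) \<longleftrightarrow>
    (\<forall>s\<in>S. \<forall>t\<in>S. (s, t) \<in> r \<or> (t, s) \<in> r) \<and>
    (\<forall>s\<in>S. \<forall>t\<in>S. (s, t) \<in> r \<longrightarrow> (t, s) \<in> r \<longrightarrow> s = t) \<and>
    (\<forall>s\<in>S. \<forall>t\<in>S. \<forall>u\<in>S. (s, t) \<in> r \<longrightarrow> (t, u) \<in> r \<longrightarrow> (s, u) \<in> r)"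
proof -
  have "trans (Restr r S) \<longleftrightarrow>
      (\<forall>s\<in>S. \<forall>t\<in>S. \<forall>u\<in>S. (s, t) \<in> r \<longrightarrow> (t, u) \<in> r \<longrightarrow> (s, u) \<in> r)"
    unfolding trans_def by simp blast
  moreover have "antisym (Restr r S) \<longleftrightarrow> (\<forall>s\<in>S. \<forall>t\<in>S. (s, t) \<in> r \<longrightarrow> (t, s) \<in> r \<longrightarrow> s = t)"
    unfolding antisym_def by simp blast
  moreover have "refl_on S (Restr r S) \<and> total_on S (Restr r S) \<longleftrightarrow>
      (\<forall>s\<in>S. \<forall>t\<in>S. (s, t) \<in> r \<or> (t, s) \<in> r)"
    unfolding refl_on_def total_on_def by simp metis
  moreover have "Restr r S \<subseteq> S \<times> S"
    by blast
  ultimately show ?thesis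
    unfolding linear_order_on_def partial_order_on_def preorder_on_def by argo
qed

lemma linear_order_on_Restr_subset:
  "linear_order_on S (Restr r S) \<Longrightarrow> S' \<subseteq> S \<Longrightarrow> linear_order_on S' (Restr r S')"
  unfolding linear_order_on_Restr_iff by (meson subsetD)

lemma linear_order_on_natLeq: "linear_order_on A (Restr natLeq A)"
  by (auto simp: linear_order_on_Restr_iff natLeq_def)

locale star_product =
  fixes r :: "'s rel" and S :: "'s set" and X :: "'s \<Rightarrow> 'a set"
    and d :: "'s \<Rightarrow> 'a \<Rightarrow> 'a \<Rightarrow> real" and a :: "'s \<Rightarrow> 'a"
  assumes order: "linear_order_on S (Restr r S)"
    and factor: "\<And>s. s \<in> S \<Longrightarrow> Metric_space (X s) (d s)"
    and base: "a \<in> PiE S X"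
begin

abbreviation "Z \<equiv> star_set r S X a"
abbreviation "\<rho> \<equiv> star_dist r S X d a"

lemma ord_total: "s \<in> S \<Longrightarrow> t \<in> S \<Longrightarrow> (s, t) \<in> r \<or> (t, s) \<in> r"
  using order unfolding linear_order_on_Restr_iff by blast

lemma ord_refl: "s \<in> S \<Longrightarrow> (s, s) \<in> r"
  using ord_total by blast

lemma ord_antisym: "(s, t) \<in> r \<Longrightarrow> (t, s) \<in> r \<Longrightarrow> s \<in> S \<Longrightarrow> t \<in> S \<Longrightarrow> s = t"
  using order unfolding linear_order_on_Restr_iff by blast

lemma ord_trans: "(s, t) \<in> r \<Longrightarrow> (t, u) \<in> r \<Longrightarrow> s \<in> S \<Longrightarrow> t \<in> S \<Longrightarrow> u \<in> S \<Longrightarrow> (s, u) \<in> r"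
  using order unfolding linear_order_on_Restr_iff by meson

lemma well_order_on_iff_least:
  assumes "D \<subseteq> S"
  shows "well_order_on D (Restr r D) \<longleftrightarrow> (\<forall>A\<subseteq>D. A \<noteq> {} \<longrightarrow> (\<exists>l. is_least r A l))"
proof -
  have "wf (Restr r D - Id) \<longleftrightarrow> (\<forall>A\<subseteq>D. A \<noteq> {} \<longrightarrow> (\<exists>l. is_least r A l))"
  proof (intro iffI allI impI)
    fix A assume wf: "wf (Restr r D - Id)" and A: "A \<subseteq> D" "A \<noteq> {}"
    then obtain l where l: "l \<in> A" "\<And>y. (y, l) \<in> Restr r D - Id \<Longrightarrow> y \<notin> A"
      unfolding wf_iff_ex_minimal by metis
    have "(l, s) \<in> r" if "s \<in> A" for s
      using l that A assms ord_total[of l s] ord_refl by blast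
    with l show "\<exists>l. is_least r A l"
      by (auto simp: is_least_def)
  next
    assume least: "\<forall>A\<subseteq>D. A \<noteq> {} \<longrightarrow> (\<exists>l. is_least r A l)"
    show "wf (Restr r D - Id)"
      unfolding wf_iff_ex_minimal
    proof (intro allI impI)
      fix B :: "'s set" assume B: "B \<noteq> {}"
      show "\<exists>z\<in>B. \<forall>y. (y, z) \<in> Restr r D - Id \<longrightarrow> y \<notin> B"
      proof (cases "B \<inter> D = {}")
        case False
        then obtain l where l: "is_least r (B \<inter> D) l"
          using least by (meson Int_lower2)
        then have "y \<notin> B" if "(y, l) \<in> Restr r D - Id" for y
          using that assms ord_antisym[of y l] by (auto simp: is_least_def)
        then show ?thesis
          using l by (auto simp: is_least_def)
      qed (use B in blast)
    qed
  qed
  then show ?thesis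
    using linear_order_on_Restr_subset[OF order assms] by (simp add: well_order_on_def)
qed

lemma star_set_iff:
  "x \<in> Z \<longleftrightarrow> x \<in> PiE S X \<and> (\<forall>A\<subseteq>diff_set S x a. A \<noteq> {} \<longrightarrow> (\<exists>l. is_least r A l))"
proof -
  have "diff_set S x a \<subseteq> S"
    by (auto simp: diff_set_def)
  then show ?thesis
    by (simp add: star_set_def well_order_on_iff_least)
qed

lemma star_set_coord: "x \<in> Z \<Longrightarrow> s \<in> S \<Longrightarrow> x s \<in> X s"
  by (auto simp: star_set_iff)

lemma star_set_eqI: "x \<in> Z \<Longrightarrow> y \<in> Z \<Longrightarrow> (\<And>s. s \<in> S \<Longrightarrow> x s = y s) \<Longrightarrow> x = y"
  by (auto simp: star_set_iff intro: PiE_ext)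

text \<open>A union of two well-ordered subsets of a chain is well-ordered: the smaller of the two least
  elements serves.  As two members of the product differ only where one of them differs from \<open>a\<close>,
  this is what makes the distance meaningful.\<close>

lemma least_diff_exists:
  assumes "x \<in> Z" "y \<in> Z" "x \<noteq> y"
  shows "\<exists>l. is_least r (diff_set S x y) l"
proof -
  let ?A = "diff_set S x y \<inter> diff_set S x a" and ?B = "diff_set S x y \<inter> diff_set S y a"
  have AB: "diff_set S x y = ?A \<union> ?B"
    by (auto simp: diff_set_def)
  have sub: "diff_set S x y \<subseteq> S"
    by (auto simp: diff_set_def)
  have ne: "diff_set S x y \<noteq> {}"
    using assms star_set_eqI[of x y] by (auto simp: diff_set_def)
  have A: "?A = {} \<or> (\<exists>l. is_least r ?A l)"
    using assms(1) unfolding star_set_iff by (meson Int_lower2)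
  have B: "?B = {} \<or> (\<exists>l. is_least r ?B l)"
    using assms(2) unfolding star_set_iff by (meson Int_lower2)
  show ?thesis
  proof (cases "?A = {} \<or> ?B = {}")
    case True
    then show ?thesis
      using A B AB ne by (metis Un_empty_left Un_empty_right)
  next
    case False
    then obtain l m where l: "is_least r ?A l" and m: "is_least r ?B m"
      using A B by blast
    have lm: "l \<in> S" "m \<in> S"
      using l m by (auto simp: is_least_def diff_set_def)
    consider "(l, m) \<in> r" | "(m, l) \<in> r"
      using ord_total lm by blast
    then show ?thesis
    proof cases
      case 1
      have "(l, s) \<in> r" if "s \<in> ?B" for s
        using m that sub ord_trans[OF 1 _ lm, of s] unfolding is_least_def by blast
      with l have "is_least r (?A \<union> ?B) l"
        unfolding is_least_def by blast
      then show ?thesis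
        using AB by metis
    next
      case 2
      have "(m, s) \<in> r" if "s \<in> ?A" for s
        using l that sub ord_trans[OF 2 _ lm(2,1), of s] unfolding is_least_def by blast
      with m have "is_least r (?A \<union> ?B) m"
        unfolding is_least_def by blast
      then show ?thesis
        using AB by metis
    qed
  qed
qed

lemma star_dist_eq:
  assumes "x \<in> Z" "y \<in> Z" "l \<in> S" "x l \<noteq> y l"
    and below: "\<And>s. s \<in> S \<Longrightarrow> (s, l) \<in> r \<Longrightarrow> s \<noteq> l \<Longrightarrow> x s = y s"
  shows "\<rho> x y = d l (x l) (y l)"
proof -
  have l: "is_least r (diff_set S x y) l"
    unfolding is_least_def diff_set_def
    using assms ord_total[of l] ord_refl by blast
  have "(THE l. is_least r (diff_set S x y) l) = l"
  proof (rule the_equality[where P = "is_least r (diff_set S x y)", OF l])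
    fix m assume "is_least r (diff_set S x y) m"
    then show "m = l"
      using l unfolding is_least_def diff_set_def by (auto intro: ord_antisym)
  qed
  then show ?thesis
    using assms by (auto simp: star_dist_def Let_def)
qed

lemma star_dist_self: "\<rho> x x = 0"
  by (simp add: star_dist_def)

lemma first_difference:
  assumes "x \<in> Z" "y \<in> Z" "x \<noteq> y"
  obtains l where "l \<in> S" "x l \<noteq> y l" "\<And>s. s \<in> S \<Longrightarrow> (s, l) \<in> r \<Longrightarrow> s \<noteq> l \<Longrightarrow> x s = y s"
    "\<rho> x y = d l (x l) (y l)"
proof -
  obtain l where l: "is_least r (diff_set S x y) l"
    using least_diff_exists[OF assms] by blast
  then have "l \<in> S" "x l \<noteq> y l"
    by (auto simp: is_least_def diff_set_def)
  moreover have "x s = y s" if "s \<in> S" "(s, l) \<in> r" "s \<noteq> l" for s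
    using l that ord_antisym[of s l] \<open>l \<in> S\<close> by (auto simp: is_least_def diff_set_def)
  ultimately show ?thesis
    using that star_dist_eq assms by metis
qed

lemma star_dist_nonneg: "\<rho> x y \<ge> 0"
proof (cases "x \<in> Z \<and> y \<in> Z \<and> x \<noteq> y")
  case True
  then show ?thesis
    by (metis first_difference Metric_space.nonneg factor)
qed (auto simp: star_dist_def)

lemma star_dist_commute: "\<rho> x y = \<rho> y x"
proof (cases "x \<in> Z \<and> y \<in> Z \<and> x \<noteq> y")
  case True
  then obtain l where l: "l \<in> S" "x l \<noteq> y l"
    "\<And>s. s \<in> S \<Longrightarrow> (s, l) \<in> r \<Longrightarrow> s \<noteq> l \<Longrightarrow> x s = y s" "\<rho> x y = d l (x l) (y l)"
    using first_difference by metis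
  then have "\<rho> y x = d l (y l) (x l)"
    using True by (intro star_dist_eq) auto
  then show ?thesis
    using l factor by (metis Metric_space.commute)
qed (auto simp: star_dist_def)

lemma star_dist_zero:
  assumes "x \<in> Z" "y \<in> Z"
  shows "\<rho> x y = 0 \<longleftrightarrow> x = y"
proof
  assume 0: "\<rho> x y = 0"
  show "x = y"
  proof (rule ccontr)
    assume "x \<noteq> y"
    then obtain l where "l \<in> S" "x l \<noteq> y l" "\<rho> x y = d l (x l) (y l)"
      using first_difference[OF assms] by metis
    then show False
      using 0 Metric_space.zero[OF factor] star_set_coord assms by metis
  qed
qed (simp add: star_dist_self)

lemma base_in: "a \<in> Z"
  using base by (auto simp: star_set_iff diff_set_def)

text \<open>One coordinate may be changed freely, since a well-ordered subset of a chain stays well-ordered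
  when one element is added to it.\<close>

lemma fun_upd_in:
  assumes x: "x \<in> Z" and s: "s \<in> S" and v: "v \<in> X s"
  shows "x(s := v) \<in> Z"
proof -
  have "x(s := v) \<in> PiE S X"
    using x s v by (auto simp: star_set_iff PiE_iff extensional_def)
  moreover have "\<exists>l. is_least r A l" if A: "A \<subseteq> diff_set S (x(s := v)) a" "A \<noteq> {}" for A
  proof (cases "A - {s} = {}")
    case True
    then have "A = {s}"
      using A by auto
    then show ?thesis
      using ord_refl s by (auto simp: is_least_def)
  next
    case False
    have "A - {s} \<subseteq> diff_set S x a"
      using A by (auto simp: diff_set_def split: if_splits)
    then obtain l where l: "is_least r (A - {s}) l"
      using x False unfolding star_set_iff by meson
    have AS: "A \<subseteq> S" "l \<in> S"
      using A l by (auto simp: diff_set_def is_least_def)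
    show ?thesis
    proof (cases "s \<in> A \<and> (s, l) \<in> r")
      case True
      then have "is_least r A s"
        using l AS s ord_refl unfolding is_least_def
        by (metis DiffI ord_trans singletonD subsetD)
      then show ?thesis ..
    next
      case False
      then have "is_least r A l"
        using l AS s ord_total[of s l] unfolding is_least_def by blast
      then show ?thesis ..
    qed
  qed
  ultimately show ?thesis
    by (simp add: star_set_iff)
qed

lemma star_dist_fun_upd:
  assumes "x \<in> Z" "s \<in> S" "u \<in> X s" "v \<in> X s"
  shows "\<rho> (x(s := u)) (x(s := v)) = d s u v"
proof (cases "u = v")
  case True
  then show ?thesis
    using assms Metric_space.mdist_zero[OF factor] by (simp add: star_dist_self)
next
  case False
  then have "\<rho> (x(s := u)) (x(s := v)) = d s ((x(s := u)) s) ((x(s := v)) s)"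
    using assms fun_upd_in by (intro star_dist_eq) auto
  then show ?thesis
    by simp
qed

lemma positive_distance:
  "s \<in> S \<Longrightarrow> x \<in> X s \<Longrightarrow> y \<in> X s \<Longrightarrow> x \<noteq> y \<Longrightarrow> d s x y \<in> positive_distances (X s) (d s)"
  using Metric_space.mdist_pos_less[OF factor] by (auto simp: positive_distances_def)

lemma positive_distanceE:
  assumes "s \<in> S" "p \<in> positive_distances (X s) (d s)"
  obtains x y where "x \<in> X s" "y \<in> X s" "x \<noteq> y" "d s x y = p" "p > 0"
  using assms Metric_space.mdist_zero[OF factor] by (force simp: positive_distances_def)

lemma support_iff: "s \<in> support S X \<longleftrightarrow> s \<in> S \<and> positive_distances (X s) (d s) \<noteq> {}"
proof
  assume "s \<in> support S X"
  then show "s \<in> S \<and> positive_distances (X s) (d s) \<noteq> {}"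
    unfolding support_def using positive_distance by blast
next
  assume s: "s \<in> S \<and> positive_distances (X s) (d s) \<noteq> {}"
  then obtain p where "p \<in> positive_distances (X s) (d s)"
    by blast
  with s obtain x y where "x \<in> X s" "y \<in> X s" "x \<noteq> y"
    by (meson positive_distanceE)
  with s show "s \<in> support S X"
    unfolding support_def by blast
qed

section \<open>When the product is a metric space\<close>

definition spread :: bool
  where "spread \<longleftrightarrow> (\<forall>s\<in>S. \<forall>t\<in>S. s \<noteq> t \<and> (s, t) \<in> r \<longrightarrow>
    (\<forall>p\<in>positive_distances (X s) (d s). \<forall>q\<in>positive_distances (X t) (d t). q \<le> 2 * p))"

text \<open>Take \<open>x\<close>, \<open>y\<close> at distance \<open>p\<close> in the factor \<open>s\<close> and \<open>u\<close>, \<open>v\<close> at distance \<open>q\<close> in the later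
  factor \<open>t\<close>.  The points with coordinates \<open>(x, u)\<close> and \<open>(x, v)\<close> at \<open>(s, t)\<close> are at distance \<open>q\<close>
  from each other, and both are at distance \<open>p\<close> from any point whose \<open>s\<close>-coordinate is \<open>y\<close> and which
  agrees with them before \<open>s\<close>.\<close>

lemma metric_imp_spread:
  assumes M: "Metric_space Z \<rho>"
  shows spread
  unfolding spread_def
proof (intro ballI impI)
  fix s t p q
  assume st: "s \<in> S" "t \<in> S" "s \<noteq> t \<and> (s, t) \<in> r"
    and p: "p \<in> positive_distances (X s) (d s)" and q: "q \<in> positive_distances (X t) (d t)"
  obtain x y where xy: "x \<in> X s" "y \<in> X s" "x \<noteq> y" "d s x y = p"
    using positive_distanceE[OF st(1) p] by metis
  obtain u v where uv: "u \<in> X t" "v \<in> X t" "u \<noteq> v" "d t u v = q"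
    using positive_distanceE[OF st(2) q] by metis
  let ?c = "a(s := x)" and ?e = "a(s := y)"
  have in_Z: "?c \<in> Z" "?e \<in> Z" "?c(t := u) \<in> Z" "?c(t := v) \<in> Z"
    using base_in fun_upd_in st xy uv by simp_all
  have "\<rho> (?c(t := u)) (?c(t := v)) = q"
    using star_dist_fun_upd in_Z st uv by metis
  moreover have "\<rho> (?c(t := w)) ?e = p" if "?c(t := w) \<in> Z" for w
  proof -
    have "\<rho> (?c(t := w)) ?e = d s ((?c(t := w)) s) (?e s)"
    proof (rule star_dist_eq[OF that in_Z(2) st(1)])
      fix m assume "m \<in> S" "(m, s) \<in> r" "m \<noteq> s"
      then show "(?c(t := w)) m = ?e m"
        using st ord_antisym by auto
    qed (use st xy in auto)
    then show ?thesis
      using st xy by simp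
  qed
  ultimately show "q \<le> 2 * p"
    using Metric_space.triangle[OF M in_Z(3,2,4)] in_Z star_dist_commute[of ?e] by simp
qed

lemma spread_imp_triangle:
  assumes spread and xyz: "x \<in> Z" "y \<in> Z" "z \<in> Z"
  shows "\<rho> x z \<le> \<rho> x y + \<rho> y z"
proof (cases "x = z \<or> x = y \<or> y = z")
  case True
  then show ?thesis
    using star_dist_nonneg by (auto simp: star_dist_self)
next
  case False
  obtain l where l: "l \<in> S" "x l \<noteq> y l" "\<And>s. s \<in> S \<Longrightarrow> (s, l) \<in> r \<Longrightarrow> s \<noteq> l \<Longrightarrow> x s = y s"
    "\<rho> x y = d l (x l) (y l)"
    using first_difference False xyz by metis
  obtain m where m: "m \<in> S" "y m \<noteq> z m" "\<And>s. s \<in> S \<Longrightarrow> (s, m) \<in> r \<Longrightarrow> s \<noteq> m \<Longrightarrow> y s = z s"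
    "\<rho> y z = d m (y m) (z m)"
    using first_difference False xyz by metis
  obtain k where k: "k \<in> S" "x k \<noteq> z k" "\<And>s. s \<in> S \<Longrightarrow> (s, k) \<in> r \<Longrightarrow> s \<noteq> k \<Longrightarrow> x s = z s"
    "\<rho> x z = d k (x k) (z k)"
    using first_difference False xyz by metis
  have pos: "d s (u s) (v s) \<in> positive_distances (X s) (d s)"
    if "s \<in> S" "u \<in> Z" "v \<in> Z" "u s \<noteq> v s" for s u v
    using that positive_distance star_set_coord by metis
  have tri: "d s (x s) (z s) \<le> d s (x s) (y s) + d s (y s) (z s)" if "s \<in> S" for s
    using Metric_space.triangle[OF factor[OF that]] star_set_coord xyz that by metis
  have self: "d s (u s) (u s) = 0" if "s \<in> S" "u \<in> Z" for s u
    using Metric_space.mdist_zero[OF factor] star_set_coord that by metis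
  have comm: "d s (u s) (v s) = d s (v s) (u s)" if "s \<in> S" for s u v
    using Metric_space.commute[OF factor[OF that]] .
  have far: "d k (x k) (z k) \<le> 2 * d s (u s) (v s)"
    if "s \<in> S" "(s, k) \<in> r" "s \<noteq> k" "u \<in> Z" "v \<in> Z" "u s \<noteq> v s" for s u v
    using assms(1) that k(1,2) pos[of k x z] pos[of s u v] xyz unfolding spread_def by blast
  \<comment> \<open>The first difference \<open>k\<close> of \<open>x\<close> and \<open>z\<close> is the smaller of \<open>l\<close> and \<open>m\<close>, unless these coincide;
    then it may come later, and this is the only case that uses the bound \<open>far\<close>.\<close>
  consider "l = m" | "l \<noteq> m" "(l, m) \<in> r" | "l \<noteq> m" "(m, l) \<in> r"
    using ord_total l(1) m(1) by blast
  then show ?thesis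
  proof cases
    case 1
    show ?thesis
    proof (cases "k = l")
      case True
      then show ?thesis
        using tri[OF l(1)] k l m 1 by simp
    next
      case False
      then have lk: "(l, k) \<in> r"
        using ord_total[OF l(1) k(1)] l(3)[OF k(1)] m(3)[OF k(1)] k(2) 1 by auto
      then have "x l = z l"
        using k(3) l(1) False by blast
      then have "\<rho> y z = d l (x l) (y l)"
        using m(4) 1 comm[OF l(1), of y x] by simp
      then show ?thesis
        using far[OF l(1) lk _ xyz(1,2) l(2)] False l(4) k(4) by simp
    qed
  next
    case 2
    have yz: "y l = z l"
      using m(3) l(1) 2 by blast
    have "(l, k) \<in> r"
      using ord_total[OF l(1) k(1)] l(3)[OF k(1)] m(3)[OF k(1)] k(2) 2 ord_trans[of k l m] ord_antisym[of l m] l(1) m(1) k(1)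
      by metis
    then have "k = l"
      using k(3)[OF l(1)] yz l(2) by auto
    then show ?thesis
      using k(4) l(4) yz star_dist_nonneg[of y z] by simp
  next
    case 3
    have xy: "x m = y m"
      using l(3) m(1) 3 by blast
    have "(m, k) \<in> r"
      using ord_total[OF m(1) k(1)] m(3)[OF k(1)] l(3)[OF k(1)] k(2) 3 ord_trans[of k m l] ord_antisym[of l m] l(1) m(1) k(1)
      by metis
    then have "k = m"
      using k(3)[OF m(1)] xy m(2) by auto
    then show ?thesis
      using k(4) m(4) xy star_dist_nonneg[of x y] by simp
  qed
qed

lemma metric_iff_spread: "Metric_space Z \<rho> \<longleftrightarrow> spread"
  using metric_imp_spread spread_imp_triangle star_dist_nonneg star_dist_commute star_dist_zero
  by (auto intro!: Metric_space.intro)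

end

text \<open>Here Cauchy sequences are eventually constant and balls of radius \<open>c\<close> are single points.\<close>

lemma uniformly_discrete:
  assumes M: "Metric_space M d" and c: "c > 0"
    and sep: "\<And>x y. x \<in> M \<Longrightarrow> y \<in> M \<Longrightarrow> x \<noteq> y \<Longrightarrow> c \<le> d x y"
  shows "complete_metric M d" "topologically_discrete M d"
proof -
  interpret M: Metric_space M d
    by (rule M)
  have "\<exists>x. limitin M.mtopology \<sigma> x sequentially" if \<sigma>: "M.MCauchy \<sigma>" for \<sigma>
  proof -
    obtain N where N: "\<And>n n'. N \<le> n \<Longrightarrow> N \<le> n' \<Longrightarrow> d (\<sigma> n) (\<sigma> n') < c"
      using \<sigma> c unfolding M.MCauchy_def by blast
    have in_M: "\<sigma> n \<in> M" for n
      using \<sigma> by (auto simp: M.MCauchy_def)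
    have "\<sigma> n = \<sigma> N" if "n \<ge> N" for n
      using sep[OF in_M in_M, of n N] N[OF that order_refl] by force
    then have "limitin M.mtopology \<sigma> (\<sigma> N) sequentially"
      unfolding M.limit_metric_sequentially using in_M by (metis M.mdist_zero)
    then show ?thesis ..
  qed
  then show "complete_metric M d"
    using M by (auto simp: complete_metric_def M.mcomplete_def)
  have "openin M.mtopology {x}" if "x \<in> M" for x
  proof -
    have "M.mball x c = {x}"
      using that c sep by force
    then show ?thesis
      by (metis M.openin_mball)
  qed
  then show "topologically_discrete M d"
    by (simp add: topologically_discrete_def eq_commute[of _ "discrete_topology M"]
        discrete_topology_unique)
qed

lemma topology_eqI:
  assumes "topspace T = topspace T'" "continuous_map T T' id" "continuous_map T' T id"
  shows "T = T'"
  using assms topology_finer_continuous_id[of T T'] topology_finer_continuous_id[of T' T]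
  by (metis topology_eq)

locale metric_star_product = star_product r S X d a
  for r :: "'s rel" and S :: "'s set" and X :: "'s \<Rightarrow> 'a set"
    and d :: "'s \<Rightarrow> 'a \<Rightarrow> 'a \<Rightarrow> real" and a :: "'s \<Rightarrow> 'a" +
  assumes spread: spread
begin

sublocale star: Metric_space Z \<rho>
  using spread metric_iff_spread by blast

lemma spreadD:
  "s \<in> S \<Longrightarrow> t \<in> S \<Longrightarrow> s \<noteq> t \<Longrightarrow> (s, t) \<in> r \<Longrightarrow> p \<in> positive_distances (X s) (d s) \<Longrightarrow>
    q \<in> positive_distances (X t) (d t) \<Longrightarrow> q \<le> 2 * p"
  using spread unfolding spread_def by blast

lemma positive_distance_star:
  assumes "q \<in> positive_distances Z \<rho>"
  obtains s where "s \<in> S" "q \<in> positive_distances (X s) (d s)"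
proof -
  obtain x y where xy: "x \<in> Z" "y \<in> Z" "\<rho> x y = q" "q > 0"
    using assms by (auto simp: positive_distances_def)
  then have "x \<noteq> y"
    using star_dist_self by auto
  with xy obtain l where "l \<in> S" "x l \<noteq> y l" "\<rho> x y = d l (x l) (y l)"
    using first_difference by metis
  then show ?thesis
    using that positive_distance star_set_coord xy by metis
qed

lemma uniformly_discrete_star:
  assumes "c > 0" "\<And>s p. s \<in> S \<Longrightarrow> p \<in> positive_distances (X s) (d s) \<Longrightarrow> c \<le> p"
  shows "complete_metric Z \<rho>" "topologically_discrete Z \<rho>"
proof -
  have sep: "c \<le> \<rho> x y" if "x \<in> Z" "y \<in> Z" "x \<noteq> y" for x y
  proof -
    obtain l where "l \<in> S" "x l \<noteq> y l" "\<rho> x y = d l (x l) (y l)"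
      using first_difference[OF \<open>x \<in> Z\<close> \<open>y \<in> Z\<close> \<open>x \<noteq> y\<close>] by metis
    then show ?thesis
      using assms(2) positive_distance star_set_coord that by metis
  qed
  show "complete_metric Z \<rho>"
    by (rule uniformly_discrete[OF star.Metric_space_axioms assms(1) sep])
  show "topologically_discrete Z \<rho>"
    by (rule uniformly_discrete[OF star.Metric_space_axioms assms(1) sep])
qed

text \<open>The first difference of \<open>x\<close> and \<open>y\<close> is at \<open>u\<close> or earlier, so before \<open>s\<close>.\<close>

lemma dist_ge_half:
  assumes xy: "x \<in> Z" "y \<in> Z" and u: "u \<in> S" "x u \<noteq> y u"
    and s: "s \<in> S" "(u, s) \<in> r" "u \<noteq> s" and q: "q \<in> positive_distances (X s) (d s)"
  shows "q \<le> 2 * \<rho> x y"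
proof -
  have "x \<noteq> y"
    using u by auto
  then obtain l where l: "l \<in> S" "x l \<noteq> y l" "\<rho> x y = d l (x l) (y l)"
    "\<And>v. v \<in> S \<Longrightarrow> (v, l) \<in> r \<Longrightarrow> v \<noteq> l \<Longrightarrow> x v = y v"
    using first_difference[OF xy] by metis
  then have lu: "(l, u) \<in> r"
    using ord_total u ord_refl by metis
  then have "(l, s) \<in> r" "l \<noteq> s"
    using ord_trans ord_antisym l(1) u(1) s by metis+
  then show ?thesis
    using spreadD[of l s] l positive_distance star_set_coord xy s(1) q by metis
qed

text \<open>By the previous lemma the two points agree before \<open>s\<close>, so \<open>s\<close> is their first difference if it is
  a difference at all.\<close>

lemma coord_dist_le:
  assumes xy: "x \<in> Z" "y \<in> Z" and s: "s \<in> S"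
    and q: "q \<in> positive_distances (X s) (d s)" "2 * \<rho> x y < q"
  shows "d s (x s) (y s) \<le> \<rho> x y"
proof (cases "x s = y s")
  case True
  then show ?thesis
    using Metric_space.mdist_zero[OF factor[OF s]] star_set_coord[OF xy(2) s] by simp
next
  case False
  have "x v = y v" if "v \<in> S" "(v, s) \<in> r" "v \<noteq> s" for v
    using dist_ge_half[OF xy that(1) _ s that(2,3) q(1)] q(2) by linarith
  then show ?thesis
    using star_dist_eq[OF xy s False] by simp
qed

text \<open>The first difference of \<open>x\<close> and \<open>y\<close>, if any, comes after \<open>s\<close>.\<close>

lemma dist_le_of_agree:
  assumes xy: "x \<in> Z" "y \<in> Z" and s: "s \<in> S" and p: "p \<in> positive_distances (X s) (d s)"
    and agree: "\<And>u. u \<in> S \<Longrightarrow> (u, s) \<in> r \<Longrightarrow> x u = y u"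
  shows "\<rho> x y \<le> 2 * p"
proof (cases "x = y")
  case True
  then show ?thesis
    using p by (simp add: star_dist_self positive_distances_def)
next
  case False
  then obtain l where l: "l \<in> S" "x l \<noteq> y l" "\<rho> x y = d l (x l) (y l)"
    using first_difference[OF xy] by metis
  then have "(s, l) \<in> r" "s \<noteq> l"
    using agree ord_total s ord_refl by metis+
  then show ?thesis
    using spreadD[of s l] l positive_distance star_set_coord xy s(1) p by metis
qed

section \<open>The topology of the product\<close>

lemma continuous_coordinate:
  assumes s: "s \<in> S"
  shows "continuous_map star.mtopology (Metric_space.mtopology (X s) (d s)) (\<lambda>x. x s)"
  unfolding star.metric_continuous_map[OF factor[OF s]]
proof (intro conjI ballI allI impI)
  show "(\<lambda>x. x s) ` Z \<subseteq> X s"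
    using star_set_coord s by auto
  fix x and \<epsilon> :: real assume x: "x \<in> Z" and \<epsilon>: "\<epsilon> > 0"
  show "\<exists>\<delta>>0. \<forall>y. y \<in> Z \<and> \<rho> x y < \<delta> \<longrightarrow> d s (x s) (y s) < \<epsilon>"
  proof (cases "positive_distances (X s) (d s) = {}")
    case True
    then have "d s (x s) (y s) = 0" if "y \<in> Z" for y
      using positive_distance[OF s, of "x s" "y s"] star_set_coord[OF x s] star_set_coord[OF that s]
        Metric_space.zero[OF factor[OF s]] by auto
    then show ?thesis
      using \<epsilon> by auto
  next
    case False
    then obtain q where q: "q \<in> positive_distances (X s) (d s)"
      by blast
    then have "q > 0"
      by (simp add: positive_distances_def)
    moreover have "d s (x s) (y s) < \<epsilon>" if "y \<in> Z" "\<rho> x y < min \<epsilon> (q / 2)" for y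
      using coord_dist_le[OF x that(1) s q] that(2) by simp
    ultimately show ?thesis
      using \<epsilon> by (intro exI[of _ "min \<epsilon> (q / 2)"]) auto
  qed
qed

lemma topspace_factor: "s \<in> S \<Longrightarrow> topspace (Metric_space.mtopology (X s) (d s)) = X s"
  by (simp add: Metric_space.topspace_mtopology factor)

lemma topspace_product:
  "topspace (product_topology (\<lambda>s. Metric_space.mtopology (X s) (d s)) S) = PiE S X"
  unfolding topspace_product_topology by (intro PiE_cong) (simp add: topspace_factor)

lemma continuous_id_product:
  "continuous_map star.mtopology (product_topology (\<lambda>s. Metric_space.mtopology (X s) (d s)) S) id"
  using continuous_coordinate
  by (auto simp: continuous_map_componentwise star_set_iff PiE_iff)

lemma finer_than_product:
  assumes "openin (subtopology (product_topology (\<lambda>s. Metric_space.mtopology (X s) (d s)) S) Z) U"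
  shows "openin star.mtopology U"
proof -
  have "continuous_map star.mtopology
      (subtopology (product_topology (\<lambda>s. Metric_space.mtopology (X s) (d s)) S) Z) id"
    using continuous_id_product by (simp add: continuous_map_in_subtopology)
  from openin_continuous_map_preimage[OF this assms] show ?thesis
    using openin_subset[OF assms]
    by (simp add: Int_absorb2 Int_def[symmetric] conj_commute topspace_subtopology Collect_conj_eq)
qed

lemma isometric_fun_upd:
  assumes "s \<in> S"
  shows "isometric_map (X s) (d s) Z \<rho> (\<lambda>v. a(s := v))"
  using assms base_in fun_upd_in star_dist_fun_upd by (auto simp: isometric_map_def)

text \<open>The image consists of the points that agree with \<open>a\<close> at every other coordinate, and each of
  these conditions is closed because coordinates are continuous and points of a metric space are
  closed.\<close>

lemma closedin_fun_upd_image: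
  assumes s: "s \<in> S"
  shows "closedin star.mtopology ((\<lambda>v. a(s := v)) ` X s)"
proof -
  have image: "(\<lambda>v. a(s := v)) ` X s = \<Inter> (insert Z ((\<lambda>u. {x \<in> Z. x u \<in> {a u}}) ` (S - {s})))"
  proof (intro equalityI subsetI)
    fix x assume x: "x \<in> \<Inter> (insert Z ((\<lambda>u. {x \<in> Z. x u \<in> {a u}}) ` (S - {s})))"
    have "x = a(s := x s)"
    proof (rule star_set_eqI)
      show "a(s := x s) \<in> Z"
        using x s base_in fun_upd_in star_set_coord by auto
    qed (use x in auto)
    then show "x \<in> (\<lambda>v. a(s := v)) ` X s"
      using x s star_set_coord by blast
  qed (use s base_in fun_upd_in in auto)
  have closed: "closedin star.mtopology {x \<in> Z. x u \<in> {a u}}" if u: "u \<in> S" for u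
  proof -
    have "closedin (Metric_space.mtopology (X u) (d u)) {a u}"
      using Metric_space.Hausdorff_space_mtopology[OF factor[OF u]] star_set_coord[OF base_in u]
        closedin_Hausdorff_sing_eq topspace_factor[OF u] by metis
    from closedin_continuous_map_preimage[OF continuous_coordinate[OF u] this]
    show ?thesis
      by simp
  qed
  show ?thesis
    unfolding image using closed by (intro closedin_Inter) auto
qed

text \<open>Requiring coordinates \<open>s \<in> F\<close> to be \<open>\<epsilon>\<close>-close for a finite set \<open>F\<close> is a neighbourhood in the
  product topology; when every distance attained at the remaining indices is below \<open>\<epsilon>\<close> anyway, it
  forces the distance in the product below \<open>\<epsilon>\<close>, wherever the first difference occurs.\<close>

lemma mtopology_eq_product_topology:
  assumes full: "Z = PiE S X"
    and small: "\<And>\<epsilon>. \<epsilon> > 0 \<Longrightarrow>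
      \<exists>F\<subseteq>S. finite F \<and> (\<forall>s\<in>S - F. \<forall>q\<in>positive_distances (X s) (d s). q < \<epsilon>)"
  shows "star.mtopology = product_topology (\<lambda>s. Metric_space.mtopology (X s) (d s)) S"
    (is "_ = ?T")
proof (rule topology_eqI)
  show top: "topspace star.mtopology = topspace ?T"
    unfolding topspace_product star.topspace_mtopology by (rule full)
  show "continuous_map star.mtopology ?T id"
    by (rule continuous_id_product)
  show "continuous_map ?T star.mtopology id"
    unfolding star.continuous_map_to_metric
  proof (intro ballI allI impI)
    fix x and \<epsilon> :: real assume "x \<in> topspace ?T" and \<epsilon>: "\<epsilon> > 0"
    then have x: "x \<in> Z"
      using top by simp
    obtain F where F: "F \<subseteq> S" "finite F"
      "\<And>s q. s \<in> S - F \<Longrightarrow> q \<in> positive_distances (X s) (d s) \<Longrightarrow> q < \<epsilon>"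
      using small[OF \<epsilon>] by metis
    define V where "V s = (if s \<in> F then Metric_space.mball (X s) (d s) (x s) \<epsilon> else X s)" for s
    have "openin ?T (PiE S V)"
    proof -
      have "finite {s \<in> S. V s \<noteq> topspace (Metric_space.mtopology (X s) (d s))}"
        by (rule finite_subset[OF _ F(2)]) (auto simp: V_def topspace_factor)
      moreover have "openin (Metric_space.mtopology (X s) (d s)) (V s)" if "s \<in> S" for s
        using Metric_space.openin_mball[OF factor[OF that]]
          Metric_space.open_in_mspace[OF factor[OF that]] by (simp add: V_def)
      ultimately show ?thesis
        by (simp add: openin_PiE_gen)
    qed
    moreover have "x \<in> PiE S V"
      using x \<epsilon> full star_set_coord
      by (auto simp: V_def PiE_iff Metric_space.centre_in_mball_iff[OF factor])
    moreover have "id y \<in> star.mball (id x) \<epsilon>" if y: "y \<in> PiE S V" for y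
    proof -
      have V: "V s \<subseteq> X s" if "s \<in> S" for s
        using Metric_space.mball_subset_mspace[OF factor[OF that]] by (simp add: V_def)
      then have yZ: "y \<in> Z"
        using y full by (auto simp: PiE_iff)
      have "\<rho> x y < \<epsilon>"
      proof (cases "x = y")
        case False
        then obtain l where l: "l \<in> S" "x l \<noteq> y l" "\<rho> x y = d l (x l) (y l)"
          using first_difference[OF x yZ] by metis
        show ?thesis
        proof (cases "l \<in> F")
          case True
          then have "y l \<in> Metric_space.mball (X l) (d l) (x l) \<epsilon>"
            using y l(1) by (auto simp: V_def PiE_iff)
          then show ?thesis
            using l Metric_space.in_mball[OF factor] by simp
        next
          case False
          then show ?thesis
            using F(3)[of l] l positive_distance star_set_coord x yZ by auto
        qed
      qed (simp add: star_dist_self \<epsilon>)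
      then show ?thesis
        using x yZ by simp
    qed
    ultimately show "\<exists>U. openin ?T U \<and> x \<in> U \<and> (\<forall>y\<in>U. id y \<in> star.mball (id x) \<epsilon>)"
      by blast
  qed
qed

section \<open>Factors that are not extreme\<close>

lemma small_distance_is_later:
  assumes "t \<in> S" "q \<in> positive_distances (X t) (d t)" "s \<in> S" "(s, t) \<in> r" "s \<noteq> t"
    "p \<in> positive_distances (X s) (d s)"
  shows "q / 2 \<le> p"
  using spreadD[of s t p q] assms by linarith

text \<open>Some index \<open>t\<close> of the support comes after \<open>s\<close>, and half a distance attained at \<open>t\<close> serves as
  \<open>c\<close>; outside the support no positive distance is attained at all.\<close>

lemma factor_not_greatest:
  assumes s: "s \<in> S" and not: "\<not> is_greatest r (support S X) s"
  obtains c where "c > 0" "\<And>p. p \<in> positive_distances (X s) (d s) \<Longrightarrow> c \<le> p"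
proof (cases "s \<in> support S X")
  case True
  then obtain t where t: "t \<in> support S X" "(t, s) \<notin> r"
    using not by (auto simp: is_greatest_def)
  then obtain q where q: "t \<in> S" "q \<in> positive_distances (X t) (d t)"
    using support_iff by blast
  have "(s, t) \<in> r" "s \<noteq> t"
    using ord_total[OF s q(1)] t(2) ord_refl[OF s] by auto
  then have "q / 2 \<le> p" if "p \<in> positive_distances (X s) (d s)" for p
    using small_distance_is_later q s that by blast
  then show ?thesis
    using that[of "q / 2"] q(2) by (simp add: positive_distances_def)
next
  case False
  then show ?thesis
    using that[of 1] s support_iff by auto
qed

lemma factor_discrete:
  assumes s: "s \<in> S" and not: "\<not> is_greatest r (support S X) s"
  shows "complete_metric (X s) (d s)" "topologically_discrete (X s) (d s)"
proof -
  obtain c where c: "c > 0" "\<And>p. p \<in> positive_distances (X s) (d s) \<Longrightarrow> c \<le> p"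
    using factor_not_greatest[OF assms] by blast
  have sep: "c \<le> d s x y" if "x \<in> X s" "y \<in> X s" "x \<noteq> y" for x y
    using c(2) positive_distance[OF s that] .
  show "complete_metric (X s) (d s)"
    by (rule uniformly_discrete[OF factor[OF s] c(1) sep])
  show "topologically_discrete (X s) (d s)"
    by (rule uniformly_discrete[OF factor[OF s] c(1) sep])
qed

text \<open>Twice a distance attained at an earlier index of the support is an upper bound.\<close>

lemma factor_bounded:
  assumes s: "s \<in> S" and not: "\<not> is_least r (support S X) s"
  shows "Metric_space.mbounded (X s) (d s) (X s)"
proof -
  have a: "a s \<in> X s"
    using star_set_coord base_in s by blast
  obtain B where B: "\<And>q. q \<in> positive_distances (X s) (d s) \<Longrightarrow> q \<le> B"
  proof (cases "s \<in> support S X")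
    case True
    then obtain t where t: "t \<in> support S X" "(s, t) \<notin> r"
      using not by (auto simp: is_least_def)
    then obtain p where p: "t \<in> S" "p \<in> positive_distances (X t) (d t)"
      using support_iff by blast
    have "(t, s) \<in> r" "t \<noteq> s"
      using ord_total[OF s p(1)] t(2) ord_refl[OF s] by auto
    then show ?thesis
      using that spreadD[OF p(1) s _ _ p(2)] by blast
  next
    case False
    then show ?thesis
      using that s support_iff by auto
  qed
  have "d s (a s) x \<le> max B 0" if "x \<in> X s" for x
  proof (cases "a s = x")
    case True
    then show ?thesis
      using Metric_space.mdist_zero[OF factor[OF s]] that by simp
  next
    case False
    then show ?thesis
      using B positive_distance[OF s a that] by force
  qed
  then have "X s \<subseteq> Metric_space.mcball (X s) (d s) (a s) (max B 0)"
    using a by (auto simp: Metric_space.in_mcball[OF factor[OF s]])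
  then show ?thesis
    using Metric_space.mbounded_def[OF factor[OF s]] by blast
qed

end

context metric_star_product
begin

section \<open>Completeness\<close>

lemma factor_complete:
  assumes Z: "complete_metric Z \<rho>" and s: "s \<in> S"
  shows "complete_metric (X s) (d s)"
proof -
  interpret factor: Metric_space "X s" "d s"
    by (rule factor[OF s])
  have "\<exists>v. limitin factor.mtopology \<sigma> v sequentially" if \<sigma>: "factor.MCauchy \<sigma>" for \<sigma>
  proof -
    have in_X: "\<sigma> n \<in> X s" for n
      using \<sigma> by (auto simp: factor.MCauchy_def)
    have "\<rho> (a(s := \<sigma> m)) (a(s := \<sigma> n)) = d s (\<sigma> m) (\<sigma> n)" for m n
      using star_dist_fun_upd[OF base_in s in_X in_X] .
    then have "star.MCauchy (\<lambda>n. a(s := \<sigma> n))"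
      using \<sigma> fun_upd_in[OF base_in s in_X] unfolding star.MCauchy_def factor.MCauchy_def by auto
    then obtain z where "limitin star.mtopology (\<lambda>n. a(s := \<sigma> n)) z sequentially"
      using Z by (auto simp: complete_metric_def star.mcomplete_def)
    from continuous_map_limit[OF continuous_coordinate[OF s] this]
    show ?thesis
      by (auto simp: o_def)
  qed
  then show ?thesis
    using factor.Metric_space_axioms by (auto simp: complete_metric_def factor.mcomplete_def)
qed

lemma coordinate_Cauchy:
  assumes \<sigma>: "star.MCauchy \<sigma>" and s: "s \<in> S"
  shows "Metric_space.MCauchy (X s) (d s) (\<lambda>n. \<sigma> n s)"
proof -
  interpret factor: Metric_space "X s" "d s"
    by (rule factor[OF s])
  have in_Z: "\<sigma> n \<in> Z" for n
    using \<sigma> by (auto simp: star.MCauchy_def)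
  have in_X: "\<sigma> n s \<in> X s" for n
    using star_set_coord in_Z s by blast
  have "\<exists>N. \<forall>m n. N \<le> m \<longrightarrow> N \<le> n \<longrightarrow> d s (\<sigma> m s) (\<sigma> n s) < \<epsilon>" if \<epsilon>: "\<epsilon> > 0" for \<epsilon>
  proof (cases "positive_distances (X s) (d s) = {}")
    case True
    then have "d s (\<sigma> m s) (\<sigma> n s) = 0" for m n
      using positive_distance[OF s in_X in_X] factor.zero[OF in_X in_X] by blast
    then show ?thesis
      using \<epsilon> by simp
  next
    case False
    then obtain q where q: "q \<in> positive_distances (X s) (d s)"
      by blast
    then have "min \<epsilon> (q / 2) > 0"
      using \<epsilon> by (simp add: positive_distances_def)
    then obtain N where N: "\<And>m n. N \<le> m \<Longrightarrow> N \<le> n \<Longrightarrow> \<rho> (\<sigma> m) (\<sigma> n) < min \<epsilon> (q / 2)"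
      using \<sigma> unfolding star.MCauchy_def by blast
    have "d s (\<sigma> m s) (\<sigma> n s) < \<epsilon>" if "N \<le> m" "N \<le> n" for m n
      using coord_dist_le[OF in_Z in_Z s q, of m n] N[OF that] by simp
    then show ?thesis
      by blast
  qed
  then show ?thesis
    using in_X by (auto simp: factor.MCauchy_def)
qed

lemma single_point_factor:
  assumes "s \<in> S" "s \<notin> support S X" "u \<in> X s" "v \<in> X s"
  shows "u = v"
  using assms by (auto simp: support_def)

lemma greatest_unique:
  "is_greatest r (support S X) s \<Longrightarrow> is_greatest r (support S X) t \<Longrightarrow> s = t"
  using ord_antisym unfolding is_greatest_def support_def by blast

text \<open>A Cauchy sequence converges in every coordinate.  Up to an index \<open>s\<close> of the support
  that is not the last one, it is even eventually constant, because positive distances there are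
  bounded below by half a distance attained later.  Hence the coordinatewise limit again differs from \<open>a\<close>
  on a well-ordered set.  It is the limit in the product: given \<open>\<epsilon>\<close>, either some such \<open>s\<close> attains
  a distance below \<open>\<epsilon> / 2\<close>, and then agreement up to \<open>s\<close> suffices, or all distances before the last
  index are at least \<open>\<epsilon> / 2\<close>, and then the sequence is eventually constant in all these coordinates at
  once and only the last factor matters.\<close>

lemma complete_star:
  assumes complete: "\<And>s. s \<in> S \<Longrightarrow> complete_metric (X s) (d s)"
  shows "complete_metric Z \<rho>"
proof -
  have "\<exists>y. limitin star.mtopology \<sigma> y sequentially" if \<sigma>: "star.MCauchy \<sigma>" for \<sigma>
  proof -
    let ?T = "support S X"
    have in_Z: "\<sigma> n \<in> Z" for n
      using \<sigma> by (auto simp: star.MCauchy_def)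
    have "\<exists>v. limitin (Metric_space.mtopology (X s) (d s)) (\<lambda>n. \<sigma> n s) v sequentially"
      if "s \<in> S" for s
      using complete[OF that] coordinate_Cauchy[OF \<sigma> that]
      by (auto simp: complete_metric_def Metric_space.mcomplete_def)
    then obtain g where g:
      "\<And>s. s \<in> S \<Longrightarrow>
        limitin (Metric_space.mtopology (X s) (d s)) (\<lambda>n. \<sigma> n s) (g s) sequentially"
      by metis
    define y where "y = restrict g S"
    have y_lim: "\<exists>N. \<forall>n\<ge>N. d s (\<sigma> n s) (y s) < \<epsilon>" if "s \<in> S" "\<epsilon> > 0" for s \<epsilon>
      using g[OF that(1)] that unfolding Metric_space.limit_metric_sequentially[OF factor[OF that(1)]]
      by (simp add: y_def) meson
    have y_in: "y s \<in> X s" if "s \<in> S" for s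
      using g[OF that] that unfolding Metric_space.limit_metric_sequentially[OF factor[OF that]]
      by (auto simp: y_def)
    have y_const: "y s = v" if s: "s \<in> S" and N: "\<And>n. n \<ge> N \<Longrightarrow> \<sigma> n s = v" for s v N
    proof -
      have v: "v \<in> X s"
        using N[of N] star_set_coord[OF in_Z[of N] s] by simp
      then have "limitin (Metric_space.mtopology (X s) (d s)) (\<lambda>n. \<sigma> n s) v sequentially"
        using N topspace_factor[OF s] by (intro limitin_eventually) (auto simp: eventually_sequentially)
      then show ?thesis
        using g[OF s] s Metric_space.limitin_metric_unique[OF factor[OF s]]
        by (metis y_def restrict_apply' trivial_limit_sequentially)
    qed
    have agree: "\<exists>N. \<forall>n\<ge>N. \<forall>u\<in>S. (u, s) \<in> r \<longrightarrow> \<sigma> n u = y u"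
      if s: "s \<in> ?T" "\<not> is_greatest r ?T s" for s
    proof -
      have sS: "s \<in> S"
        using s by (simp add: support_def)
      obtain t where t: "t \<in> ?T" "(t, s) \<notin> r"
        using s by (auto simp: is_greatest_def)
      then obtain q where q: "t \<in> S" "q \<in> positive_distances (X t) (d t)"
        using support_iff by blast
      have st: "(s, t) \<in> r"
        using ord_total[OF sS q(1)] t(2) by blast
      have "q / 2 > 0"
        using q by (simp add: positive_distances_def)
      then obtain N where N: "\<And>m n. N \<le> m \<Longrightarrow> N \<le> n \<Longrightarrow> \<rho> (\<sigma> m) (\<sigma> n) < q / 2"
        using \<sigma> unfolding star.MCauchy_def by blast
      have const: "\<sigma> n u = \<sigma> N u" if "n \<ge> N" "u \<in> S" "(u, s) \<in> r" for n u
      proof (rule ccontr)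
        assume "\<sigma> n u \<noteq> \<sigma> N u"
        moreover have "(u, t) \<in> r" "u \<noteq> t"
          using ord_trans[OF that(3) st that(2) sS q(1)] that t(2) by auto
        ultimately show False
          using dist_ge_half[OF in_Z in_Z that(2) _ q(1) _ _ q(2), of n N] N[OF that(1) order_refl]
          by simp
      qed
      have "\<sigma> n u = y u" if "n \<ge> N" "u \<in> S" "(u, s) \<in> r" for n u
        using y_const[OF that(2) const] that const by metis
      then show ?thesis
        by blast
    qed
    have yZ: "y \<in> Z"
      unfolding star_set_iff
    proof (intro conjI allI impI)
      show "y \<in> PiE S X"
        using y_in by (auto simp: y_def)
      fix A assume A: "A \<subseteq> diff_set S y a" "A \<noteq> {}"
      have AS: "A \<subseteq> S"
        using A by (auto simp: diff_set_def)
      moreover have "y s \<noteq> a s" if "s \<in> A" for s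
        using A that by (auto simp: diff_set_def)
      ultimately have AT: "A \<subseteq> ?T"
        using y_in star_set_coord[OF base_in] single_point_factor by blast
      show "\<exists>l. is_least r A l"
      proof (cases "\<exists>s\<in>A. \<not> is_greatest r ?T s")
        case True
        then obtain s where s: "s \<in> A" "\<not> is_greatest r ?T s"
          by blast
        then obtain N where N: "\<And>u. u \<in> S \<Longrightarrow> (u, s) \<in> r \<Longrightarrow> \<sigma> N u = y u"
          using agree AT by blast
        let ?A = "{u \<in> A. (u, s) \<in> r}"
        have "?A \<subseteq> diff_set S (\<sigma> N) a"
          using A N by (auto simp: diff_set_def)
        moreover have "?A \<noteq> {}"
          using s AS ord_refl by blast
        ultimately obtain l where l: "is_least r ?A l"
          using in_Z[of N] unfolding star_set_iff by meson
        then have lS: "l \<in> A" "l \<in> S" "(l, s) \<in> r"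
          using AS by (auto simp: is_least_def)
        have "(l, v) \<in> r" if v: "v \<in> A" for v
        proof (cases "(v, s) \<in> r")
          case True
          then show ?thesis
            using l v by (auto simp: is_least_def)
        next
          case False
          then have "(s, v) \<in> r"
            using ord_total s v AS by blast
          then show ?thesis
            using ord_trans[OF lS(3)] lS(2) s(1) v AS by blast
        qed
        then show ?thesis
          using lS by (auto simp: is_least_def)
      next
        case False
        then obtain s where "A = {s}"
          using A(2) greatest_unique by blast
        then show ?thesis
          using ord_refl AS by (auto simp: is_least_def)
      qed
    qed
    have "\<exists>N. \<forall>n\<ge>N. \<rho> (\<sigma> n) y < \<epsilon>" if \<epsilon>: "\<epsilon> > 0" for \<epsilon>
    proof (cases "\<exists>s\<in>?T. \<not> is_greatest r ?T s \<and> (\<exists>p\<in>positive_distances (X s) (d s). 2 * p < \<epsilon>)")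
      case True
      then obtain s p where s: "s \<in> ?T" "\<not> is_greatest r ?T s"
        and p: "p \<in> positive_distances (X s) (d s)" "2 * p < \<epsilon>"
        by blast
      obtain N where N: "\<And>n u. n \<ge> N \<Longrightarrow> u \<in> S \<Longrightarrow> (u, s) \<in> r \<Longrightarrow> \<sigma> n u = y u"
        using agree[OF s] by blast
      have "s \<in> S"
        using s by (simp add: support_def)
      then have "\<rho> (\<sigma> n) y < \<epsilon>" if "n \<ge> N" for n
        using dist_le_of_agree[OF in_Z yZ _ p(1) N[OF that]] p(2) by force
      then show ?thesis
        by blast
    next
      case False
      then have large: "\<epsilon> / 2 \<le> p"
        if "s \<in> ?T" "\<not> is_greatest r ?T s" "p \<in> positive_distances (X s) (d s)" for s p
        using that by fastforce
      obtain N where N: "\<And>m n. N \<le> m \<Longrightarrow> N \<le> n \<Longrightarrow> \<rho> (\<sigma> m) (\<sigma> n) < \<epsilon> / 2"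
        using \<sigma> half_gt_zero[OF \<epsilon>] unfolding star.MCauchy_def by blast
      have const: "\<sigma> m s = \<sigma> n s"
        if s: "s \<in> S" "\<not> is_greatest r ?T s" and mn: "N \<le> m" "N \<le> n" for s m n
      proof (rule ccontr)
        assume ne: "\<sigma> m s \<noteq> \<sigma> n s"
        then have sT: "s \<in> ?T"
          using single_point_factor[OF s(1)] star_set_coord[OF in_Z s(1)] by blast
        from ne have "\<sigma> m \<noteq> \<sigma> n"
          by auto
        then obtain l where l: "l \<in> S" "\<sigma> m l \<noteq> \<sigma> n l" "\<rho> (\<sigma> m) (\<sigma> n) = d l (\<sigma> m l) (\<sigma> n l)"
          "\<And>v. v \<in> S \<Longrightarrow> (v, l) \<in> r \<Longrightarrow> v \<noteq> l \<Longrightarrow> \<sigma> m v = \<sigma> n v"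
          using first_difference[OF in_Z in_Z] by metis
        have lT: "l \<in> ?T"
          using l single_point_factor[OF l(1)] star_set_coord[OF in_Z l(1)] by blast
        have "(l, s) \<in> r"
          using l ne ord_total s(1) by metis
        then have "\<not> is_greatest r ?T l"
          using s sT ord_antisym[OF _ _ l(1) s(1)] unfolding is_greatest_def by metis
        then have "\<epsilon> / 2 \<le> \<rho> (\<sigma> m) (\<sigma> n)"
          using large[OF lT] l positive_distance star_set_coord[OF in_Z l(1)] by metis
        then show False
          using N[OF mn] by simp
      qed
      have eq: "\<sigma> n s = y s" if "s \<in> S" "\<not> is_greatest r ?T s" "N \<le> n" for s n
        using y_const[OF that(1), of N "\<sigma> n s"] const that by metis
      obtain K where K: "\<And>n t. K \<le> n \<Longrightarrow> is_greatest r ?T t \<Longrightarrow> d t (\<sigma> n t) (y t) < \<epsilon>"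
      proof (cases "\<exists>t. is_greatest r ?T t")
        case True
        then obtain t where t: "is_greatest r ?T t"
          by blast
        then have "t \<in> S"
          by (simp add: is_greatest_def support_def)
        then obtain K where "\<And>n. K \<le> n \<Longrightarrow> d t (\<sigma> n t) (y t) < \<epsilon>"
          using y_lim \<epsilon> by blast
        then show ?thesis
          using that greatest_unique[OF t] by metis
      qed (use that in blast)
      have "\<rho> (\<sigma> n) y < \<epsilon>" if n: "max N K \<le> n" for n
      proof (cases "\<sigma> n = y")
        case False
        then obtain l where "l \<in> S" "\<sigma> n l \<noteq> y l" "\<rho> (\<sigma> n) y = d l (\<sigma> n l) (y l)"
          using first_difference[OF in_Z yZ] by metis
        then show ?thesis
          using eq K n by (metis max.bounded_iff)
      qed (simp add: star_dist_self \<epsilon>)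
      then show ?thesis
        by blast
    qed
    then have "limitin star.mtopology \<sigma> y sequentially"
      using in_Z yZ by (auto simp: star.limit_metric_sequentially)
    then show ?thesis
      by blast
  qed
  then show ?thesis
    using star.Metric_space_axioms by (auto simp: complete_metric_def star.mcomplete_def)
qed

lemma complete_star_iff: "complete_metric Z \<rho> \<longleftrightarrow> (\<forall>s\<in>S. complete_metric (X s) (d s))"
  using complete_star factor_complete by blast

section \<open>Restricting the index set\<close>

lemma sub_product:
  assumes "S' \<subseteq> S"
  shows "metric_star_product r S' X d (restrict a S')"
proof -
  interpret sub: star_product r S' X d "restrict a S'"
    using linear_order_on_Restr_subset[OF order assms] factor assms star_set_coord[OF base_in]
    by (intro star_product.intro) auto
  have "sub.spread"
    using spread assms unfolding sub.spread_def spread_def by blast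
  then show ?thesis
    by unfold_locales
qed

lemma restrict_in:
  assumes S': "S' \<subseteq> S" and x: "x \<in> Z"
  shows "restrict x S' \<in> star_set r S' X (restrict a S')"
proof -
  interpret sub: metric_star_product r S' X d "restrict a S'"
    by (rule sub_product[OF S'])
  have "diff_set S' (restrict x S') (restrict a S') \<subseteq> diff_set S x a"
    using S' by (auto simp: diff_set_def)
  moreover have "restrict x S' \<in> PiE S' X"
    using x S' star_set_coord by auto
  ultimately show ?thesis
    using x unfolding sub.star_set_iff star_set_iff by (meson order_trans)
qed

lemma extend_in:
  assumes S': "S' \<subseteq> S" and z: "z \<in> star_set r S' X (restrict a S')"
  shows "(\<lambda>s. if s \<in> S' then z s else a s) \<in> Z"
proof -
  interpret sub: metric_star_product r S' X d "restrict a S'"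
    by (rule sub_product[OF S'])
  let ?x = "\<lambda>s. if s \<in> S' then z s else a s"
  have "diff_set S ?x a \<subseteq> diff_set S' z (restrict a S')"
    by (auto simp: diff_set_def)
  moreover have "?x \<in> PiE S X"
    using z S' sub.star_set_coord base by (auto simp: PiE_iff extensional_def)
  ultimately show ?thesis
    using z unfolding sub.star_set_iff star_set_iff by (meson order_trans)
qed

lemma star_dist_restrict:
  assumes S': "S' \<subseteq> S" and xy: "x \<in> Z" "y \<in> Z" and l: "l \<in> S'" "x l \<noteq> y l"
    and below: "\<And>s. s \<in> S' \<Longrightarrow> (s, l) \<in> r \<Longrightarrow> s \<noteq> l \<Longrightarrow> x s = y s"
  shows "star_dist r S' X d (restrict a S') (restrict x S') (restrict y S') = d l (x l) (y l)"
proof -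
  interpret sub: metric_star_product r S' X d "restrict a S'"
    by (rule sub_product[OF S'])
  show ?thesis
    using sub.star_dist_eq[OF restrict_in[OF S' xy(1)] restrict_in[OF S' xy(2)] l(1)] l below
    by auto
qed

lemma sub_product_discrete:
  assumes S': "S' \<subseteq> S" and t: "t \<in> support S X"
    and below: "\<And>s. s \<in> S' \<Longrightarrow> s \<in> support S X \<Longrightarrow> (s, t) \<in> r \<and> s \<noteq> t"
  obtains c where "c > 0" "\<And>s p. s \<in> S' \<Longrightarrow> p \<in> positive_distances (X s) (d s) \<Longrightarrow> c \<le> p"
    "complete_metric (star_set r S' X (restrict a S')) (star_dist r S' X d (restrict a S'))"
    "topologically_discrete (star_set r S' X (restrict a S')) (star_dist r S' X d (restrict a S'))"
proof -
  interpret sub: metric_star_product r S' X d "restrict a S'"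
    by (rule sub_product[OF S'])
  obtain q where q: "t \<in> S" "q \<in> positive_distances (X t) (d t)"
    using t support_iff by blast
  have c: "q / 2 > 0"
    using q by (simp add: positive_distances_def)
  have le: "q / 2 \<le> p" if "s \<in> S'" "p \<in> positive_distances (X s) (d s)" for s p
    using small_distance_is_later[OF q, of s p] below[of s] support_iff that S' by blast
  show ?thesis
    by (rule that[OF c le sub.uniformly_discrete_star[OF c le]])
qed

end

section \<open>Splitting off the last factor\<close>

text \<open>Nonnegativity and symmetry are part of \<^locale>\<open>Metric_space\<close> off the carrier too, where an isometry
  says nothing.\<close>

lemma isometry_onto_Metric_space:
  assumes M: "Metric_space M d" and f: "isometry_onto M d N e f"
    and e: "\<And>x y. e x y \<ge> 0" "\<And>x y. e x y = e y x"
  shows "Metric_space N e"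
proof
  have iso: "e (f x) (f y) = d x y" if "x \<in> M" "y \<in> M" for x y
    using f that by (auto simp: isometry_onto_def isometric_map_def)
  have N: "N = f ` M"
    using f by (simp add: isometry_onto_def bij_betw_def)
  show "e x y = 0 \<longleftrightarrow> x = y" if xy: "x \<in> N" "y \<in> N" for x y
  proof -
    obtain u v where "u \<in> M" "x = f u" "v \<in> M" "y = f v"
      using xy unfolding N by blast
    then show ?thesis
      using iso Metric_space.zero[OF M] inj_onD[of f M u v] f
      by (auto simp: isometry_onto_def bij_betw_def)
  qed
  show "e x z \<le> e x y + e y z" if "x \<in> N" "y \<in> N" "z \<in> N" for x y z
    using that iso Metric_space.triangle[OF M] unfolding N by auto
qed (use e in auto)

text \<open>Below the distance \<open>c\<close> the first components must be equal, so small distances in the product are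
  distances of second components.\<close>

lemma pair_star_dist_topology:
  assumes M: "Metric_space M d" and N: "Metric_space N e"
    and P: "Metric_space (M \<times> N) (pair_star_dist d e)"
    and c: "c > 0" "\<And>x y. x \<in> M \<Longrightarrow> y \<in> M \<Longrightarrow> x \<noteq> y \<Longrightarrow> c \<le> d x y"
  shows "Metric_space.mtopology (M \<times> N) (pair_star_dist d e) =
    prod_topology (Metric_space.mtopology M d) (Metric_space.mtopology N e)"
    (is "_ = ?T")
proof -
  interpret M: Metric_space M d by (rule M)
  interpret N: Metric_space N e by (rule N)
  interpret P: Metric_space "M \<times> N" "pair_star_dist d e" by (rule P)
  show ?thesis
  proof (rule topology_eqI)
    show "topspace P.mtopology = topspace ?T"
      by simp
    have "continuous_map P.mtopology M.mtopology fst"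
      unfolding P.metric_continuous_map[OF M]
      by (auto simp: pair_star_dist_def intro!: exI split: if_splits)
    moreover have "continuous_map P.mtopology N.mtopology snd"
      unfolding P.metric_continuous_map[OF N]
    proof (intro conjI ballI allI impI)
      fix p and \<epsilon> :: real assume p: "p \<in> M \<times> N" and \<epsilon>: "\<epsilon> > 0"
      have "e (snd p) (snd q) < \<epsilon>" if "q \<in> M \<times> N" "pair_star_dist d e p q < min \<epsilon> c" for q
        using c(2)[of "fst p" "fst q"] p that
        by (auto simp: pair_star_dist_def split: if_splits)
      then show "\<exists>\<delta>>0. \<forall>q. q \<in> M \<times> N \<and> pair_star_dist d e p q < \<delta> \<longrightarrow> e (snd p) (snd q) < \<epsilon>"
        using \<epsilon> c(1) by (intro exI[of _ "min \<epsilon> c"]) auto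
    qed auto
    ultimately show "continuous_map P.mtopology ?T id"
      by (simp add: continuous_map_pairwise)
    show "continuous_map ?T P.mtopology id"
      unfolding P.continuous_map_to_metric
    proof (intro ballI allI impI)
      fix p and \<epsilon> :: real assume "p \<in> topspace ?T" and \<epsilon>: "\<epsilon> > 0"
      then have p: "fst p \<in> M" "snd p \<in> N"
        by auto
      let ?U = "M.mball (fst p) \<epsilon> \<times> N.mball (snd p) \<epsilon>"
      have "openin ?T ?U"
        by (simp add: openin_prod_Times_iff)
      moreover have "p \<in> ?U"
        using p \<epsilon> by (simp add: mem_Times_iff)
      moreover have "id q \<in> P.mball (id p) \<epsilon>" if q: "q \<in> ?U" for q
      proof -
        have "q \<in> M \<times> N" "pair_star_dist d e p q < \<epsilon>"
          using q by (auto simp: pair_star_dist_def split: prod.splits)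
        then show ?thesis
          using p by (simp add: mem_Times_iff)
      qed
      ultimately show "\<exists>U. openin ?T U \<and> p \<in> U \<and> (\<forall>q\<in>U. id q \<in> P.mball (id p) \<epsilon>)"
        by blast
    qed
  qed
qed

context metric_star_product
begin

text \<open>If two points differ anywhere outside \<open>t\<close>, they do so at an index of the support, which precedes
  \<open>t\<close>; their first difference is then an index other than \<open>t\<close>.\<close>

lemma isometry_split_last:
  assumes t: "is_greatest r (support S X) t"
  defines "a' \<equiv> restrict a (S - {t})"
  shows "isometry_onto Z \<rho> (star_set r (S - {t}) X a' \<times> X t)
    (pair_star_dist (star_dist r (S - {t}) X d a') (d t)) (\<lambda>x. (restrict x (S - {t}), x t))"
    (is "isometry_onto _ _ ?P ?\<pi> ?f")
proof -
  have S': "S - {t} \<subseteq> S" and tS: "t \<in> S"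
    using t by (auto simp: is_greatest_def support_def)
  have maps: "?f x \<in> ?P" if "x \<in> Z" for x
    using restrict_in[OF S' that] star_set_coord[OF that tS] by (simp add: a'_def)
  have dist: "?\<pi> (?f x) (?f y) = \<rho> x y" if xy: "x \<in> Z" "y \<in> Z" for x y
  proof (cases "restrict x (S - {t}) = restrict y (S - {t})")
    case True
    then have eq: "x s = y s" if "s \<in> S" "s \<noteq> t" for s
      using that by (metis DiffI restrict_apply' singletonD)
    show ?thesis
    proof (cases "x t = y t")
      case True
      then have "x = y"
        using star_set_eqI[OF xy] eq by metis
      then show ?thesis
        using Metric_space.mdist_zero[OF factor[OF tS]] star_set_coord[OF xy(1) tS]
        by (simp add: pair_star_dist_def star_dist_self)
    next
      case False
      then show ?thesis
        using star_dist_eq[OF xy tS False] eq \<open>restrict x _ = _\<close> by (simp add: pair_star_dist_def)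
    qed
  next
    case False
    then obtain s where s: "s \<in> S" "s \<noteq> t" "x s \<noteq> y s"
      by (metis DiffD1 DiffD2 insertI1 restrict_ext)
    then have "(s, t) \<in> r"
      using t single_point_factor[OF s(1)] star_set_coord xy unfolding is_greatest_def by blast
    moreover obtain l where l: "l \<in> S" "x l \<noteq> y l" "\<rho> x y = d l (x l) (y l)"
      "\<And>v. v \<in> S \<Longrightarrow> (v, l) \<in> r \<Longrightarrow> v \<noteq> l \<Longrightarrow> x v = y v"
      using first_difference[OF xy] s(3) by metis
    ultimately have "l \<in> S - {t}"
      using s by blast
    then show ?thesis
      using False star_dist_restrict[OF S' xy _ l(2)] l S'
      by (auto simp: pair_star_dist_def a'_def)
  qed
  have inj: "inj_on ?f Z"
  proof (rule inj_onI)
    fix x y assume xy: "x \<in> Z" "y \<in> Z" and eq: "?f x = ?f y"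
    have "x s = y s" if "s \<in> S" for s
      using eq that by (cases "s = t") (auto dest!: fun_cong[of _ _ s])
    then show "x = y"
      by (rule star_set_eqI[OF xy])
  qed
  have surj: "p \<in> ?f ` Z" if p: "p \<in> ?P" for p
  proof -
    obtain z u where zu: "p = (z, u)" "z \<in> star_set r (S - {t}) X a'" "u \<in> X t"
      using p by blast
    let ?x = "(\<lambda>s. if s \<in> S - {t} then z s else a s)(t := u)"
    have x_in: "?x \<in> Z"
      using fun_upd_in[OF extend_in[OF S' zu(2)[unfolded a'_def]] tS zu(3)] .
    have "z \<in> extensional (S - {t})"
      using zu(2) by (auto simp: star_set_def PiE_iff)
    then have "?f ?x = p"
      by (auto simp: zu(1) extensional_def restrict_def)
    then show ?thesis
      using imageI[OF x_in, of ?f] by (simp only:)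
  qed
  show ?thesis
    unfolding isometry_onto_def isometric_map_def bij_betw_def
    using maps dist inj surj by blast
qed

lemma split_last:
  assumes t: "is_greatest r (support S X) t"
  defines "a' \<equiv> restrict a (S - {t})"
  defines "Z' \<equiv> star_set r (S - {t}) X a'" and "\<rho>' \<equiv> star_dist r (S - {t}) X d a'"
  shows "complete_metric Z' \<rho>'" "topologically_discrete Z' \<rho>'"
    "Metric_space (Z' \<times> X t) (pair_star_dist \<rho>' (d t))"
    "Metric_space.mtopology (Z' \<times> X t) (pair_star_dist \<rho>' (d t)) =
      prod_topology (Metric_space.mtopology Z' \<rho>') (Metric_space.mtopology (X t) (d t))"
proof -
  have S': "S - {t} \<subseteq> S" and tT: "t \<in> support S X" and tS: "t \<in> S"
    using t by (auto simp: is_greatest_def support_def)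
  interpret sub: metric_star_product r "S - {t}" X d a'
    unfolding a'_def by (rule sub_product[OF S'])
  have "(s, t) \<in> r \<and> s \<noteq> t" if "s \<in> S - {t}" "s \<in> support S X" for s
    using t that by (auto simp: is_greatest_def)
  then obtain c where c: "c > 0" "\<And>s p. s \<in> S - {t} \<Longrightarrow> p \<in> positive_distances (X s) (d s) \<Longrightarrow> c \<le> p"
    and discrete: "complete_metric Z' \<rho>'" "topologically_discrete Z' \<rho>'"
    using sub_product_discrete[OF S' tT] unfolding Z'_def \<rho>'_def a'_def by metis
  show "complete_metric Z' \<rho>'" "topologically_discrete Z' \<rho>'"
    by (rule discrete)+
  have sep: "c \<le> \<rho>' x y" if xy: "x \<in> Z'" "y \<in> Z'" "x \<noteq> y" for x y
  proof -
    have "\<rho>' x y \<in> positive_distances Z' \<rho>'"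
      using that sub.star.mdist_pos_less unfolding positive_distances_def Z'_def \<rho>'_def by blast
    then show ?thesis
      using sub.positive_distance_star c(2) unfolding Z'_def \<rho>'_def by metis
  qed
  have Z': "Metric_space Z' \<rho>'"
    unfolding Z'_def \<rho>'_def by (rule sub.star.Metric_space_axioms)
  show P: "Metric_space (Z' \<times> X t) (pair_star_dist \<rho>' (d t))"
  proof (rule isometry_onto_Metric_space[OF star.Metric_space_axioms])
    show "isometry_onto Z \<rho> (Z' \<times> X t) (pair_star_dist \<rho>' (d t)) (\<lambda>x. (restrict x (S - {t}), x t))"
      unfolding Z'_def \<rho>'_def a'_def by (rule isometry_split_last[OF t])
    show "pair_star_dist \<rho>' (d t) p q \<ge> 0" for p q
      using Metric_space.nonneg[OF Z'] Metric_space.nonneg[OF factor[OF tS]]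
      by (auto simp: pair_star_dist_def split: prod.splits)
    show "pair_star_dist \<rho>' (d t) p q = pair_star_dist \<rho>' (d t) q p" for p q
      using Metric_space.commute[OF Z'] Metric_space.commute[OF factor[OF tS]]
      by (auto simp: pair_star_dist_def split: prod.splits)
  qed
  show "Metric_space.mtopology (Z' \<times> X t) (pair_star_dist \<rho>' (d t)) =
      prod_topology (Metric_space.mtopology Z' \<rho>') (Metric_space.mtopology (X t) (d t))"
    by (rule pair_star_dist_topology[OF Z' factor[OF tS] P c(1) sep])
qed

end

section \<open>Grouping the factors into consecutive blocks\<close>

text \<open>Indices outside the support may lie above all blocks; the coordinates there are determined, as
  the factors are single points.\<close>

locale blocked_product = metric_star_product r S X d a
  for r :: "'s rel" and S :: "'s set" and X :: "'s \<Rightarrow> 'a set"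
    and d :: "'s \<Rightarrow> 'a \<Rightarrow> 'a \<Rightarrow> real" and a :: "'s \<Rightarrow> 'a" +
  fixes B :: "nat \<Rightarrow> 's set"
  assumes block_sub: "n \<ge> 1 \<Longrightarrow> B n \<subseteq> S"
    and block_mono: "1 \<le> m \<Longrightarrow> m < n \<Longrightarrow> s \<in> B m \<Longrightarrow> u \<in> B n \<Longrightarrow> (s, u) \<in> r \<and> s \<noteq> u"
    and block_cover: "s \<in> support S X \<Longrightarrow> \<exists>n\<ge>1. s \<in> B n"
begin

abbreviation "W \<equiv> \<lambda>n. star_set r (B n) X (restrict a (B n))"
abbreviation "\<mu> \<equiv> \<lambda>n. star_dist r (B n) X d (restrict a (B n))"
abbreviation "b \<equiv> restrict (\<lambda>n. restrict a (B n)) {1..}"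

lemma block_product: "n \<ge> 1 \<Longrightarrow> metric_star_product r (B n) X d (restrict a (B n))"
  by (rule sub_product[OF block_sub])

text \<open>A distance attained in the product over a block is attained in one of its factors, so the condition
  \<open>q \<le> 2 * p\<close> passes from the factors to the blocks.\<close>

lemma metric_star_product_blocks: "metric_star_product natLeq {1..} W \<mu> b"
proof -
  interpret blocks: star_product natLeq "{1..}" W \<mu> b
  proof (rule star_product.intro)
    show "linear_order_on {1..} (Restr natLeq {1..})"
      by (rule linear_order_on_natLeq)
    show "Metric_space (W n) (\<mu> n)" if "n \<in> {1..}" for n
    proof -
      interpret sub: metric_star_product r "B n" X d "restrict a (B n)"
        using that by (intro block_product) simp
      show ?thesis
        by (rule sub.star.Metric_space_axioms)
    qed
    show "b \<in> PiE {1..} W"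
      using restrict_in[OF block_sub base_in] by auto
  qed
  have "blocks.spread"
    unfolding blocks.spread_def
  proof (intro ballI impI)
    fix m n p q
    assume "m \<in> {1..}" "m \<noteq> n \<and> (m, n) \<in> natLeq"
      and p: "p \<in> positive_distances (W m) (\<mu> m)" and q: "q \<in> positive_distances (W n) (\<mu> n)"
    then have mn: "1 \<le> m" "m < n"
      by (simp_all add: natLeq_def)
    then have "1 \<le> n"
      by simp
    obtain s where s: "s \<in> B m" "p \<in> positive_distances (X s) (d s)"
      using metric_star_product.positive_distance_star[OF block_product[OF mn(1)] p] by metis
    obtain u where u: "u \<in> B n" "q \<in> positive_distances (X u) (d u)"
      using metric_star_product.positive_distance_star[OF block_product[OF \<open>1 \<le> n\<close>] q] by metis
    show "q \<le> 2 * p"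
      using block_mono[OF mn s(1) u(1)] block_sub[OF mn(1)] block_sub[OF \<open>1 \<le> n\<close>] s(1) u(1)
      by (intro spreadD[OF _ _ _ _ s(2) u(2)]) auto
  qed
  then show ?thesis
    by unfold_locales
qed

sublocale blocks: metric_star_product natLeq "{1..}" W \<mu> b
  by (rule metric_star_product_blocks)

lemma block_unique:
  assumes "1 \<le> m" "1 \<le> n" "s \<in> B m" "s \<in> B n"
  shows "m = n"
  using block_mono[of m n s s] block_mono[of n m s s] assms by (metis linorder_neqE_nat)

text \<open>A point of the product of the blocks is glued together from its components.  Its difference set
  from \<open>a\<close> is well-ordered: the least element lies in the first block that is met.\<close>

lemma glue:
  assumes w: "w \<in> blocks.Z"
  obtains x where "x \<in> Z" "\<And>n. 1 \<le> n \<Longrightarrow> restrict x (B n) = w n"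
proof -
  have wn: "w n \<in> W n" if "1 \<le> n" for n
    using blocks.star_set_coord[OF w, of n] that by simp
  \<comment> \<open>Blocks are disjoint, so the choice of \<open>n\<close> is forced; off the blocks \<open>a\<close> supplies the value, which
    is \<open>undefined\<close> outside \<open>S\<close>.\<close>
  define x where
    "x s = (if \<exists>n\<ge>1. s \<in> B n then w (SOME n. 1 \<le> n \<and> s \<in> B n) s else a s)" for s
  have x: "x s = w n s" if "1 \<le> n" "s \<in> B n" for s n
  proof -
    have "1 \<le> (SOME n. 1 \<le> n \<and> s \<in> B n) \<and> s \<in> B (SOME n. 1 \<le> n \<and> s \<in> B n)"
      using that by (intro someI[of "\<lambda>n. 1 \<le> n \<and> s \<in> B n"]) simp
    then have "(SOME n. 1 \<le> n \<and> s \<in> B n) = n"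
      using that block_unique by blast
    then show ?thesis
      using that by (auto simp: x_def)
  qed
  have x_else: "x s = a s" if "\<nexists>n. 1 \<le> n \<and> s \<in> B n" for s
    using that by (auto simp: x_def)
  have xPi: "x \<in> PiE S X"
  proof (rule PiE_I)
    fix s assume s: "s \<in> S"
    show "x s \<in> X s"
    proof (cases "\<exists>n\<ge>1. s \<in> B n")
      case True
      then obtain n where n: "1 \<le> n" "s \<in> B n"
        by blast
      interpret sub: metric_star_product r "B n" X d "restrict a (B n)"
        by (rule block_product[OF n(1)])
      show ?thesis
        using x[OF n] sub.star_set_coord[OF wn[OF n(1)] n(2)] by simp
    next
      case False
      then show ?thesis
        using x_else star_set_coord[OF base_in s] by simp
    qed
  next
    fix s assume "s \<notin> S"
    then show "x s = undefined"
      using x_else[of s] block_sub base by (auto simp: PiE_iff extensional_def)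
  qed
  have "\<exists>l. is_least r A l" if A: "A \<subseteq> diff_set S x a" "A \<noteq> {}" for A
  proof -
    have in_block: "\<exists>n\<ge>1. s \<in> B n" if "s \<in> A" for s
      using that A x_else by (auto simp: diff_set_def)
    define n where "n = (LEAST n. 1 \<le> n \<and> A \<inter> B n \<noteq> {})"
    have ex: "\<exists>n. 1 \<le> n \<and> A \<inter> B n \<noteq> {}"
      using in_block A(2) by blast
    have n: "1 \<le> n" "A \<inter> B n \<noteq> {}"
      using LeastI_ex[OF ex] unfolding n_def by blast+
    have n_le: "n \<le> m" if "1 \<le> m" "s \<in> A" "s \<in> B m" for m s
      unfolding n_def using that by (intro Least_le) blast
    interpret sub: metric_star_product r "B n" X d "restrict a (B n)"
      by (rule block_product[OF n(1)])
    have "A \<inter> B n \<subseteq> diff_set (B n) (w n) (restrict a (B n))"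
      using A x[OF n(1)] by (auto simp: diff_set_def)
    then obtain l where l: "is_least r (A \<inter> B n) l"
      using wn[OF n(1)] n(2) unfolding sub.star_set_iff by meson
    have "(l, v) \<in> r" if v: "v \<in> A" for v
    proof -
      obtain m where m: "1 \<le> m" "v \<in> B m"
        using in_block v by blast
      then have "m = n \<or> n < m"
        using n_le v by force
      then show ?thesis
        using l v m block_mono[OF n(1), of m l v] by (auto simp: is_least_def)
    qed
    then show ?thesis
      using l by (auto simp: is_least_def)
  qed
  then have "x \<in> Z"
    using xPi by (simp add: star_set_iff)
  moreover have "restrict x (B n) = w n" if n: "1 \<le> n" for n
  proof -
    have "w n \<in> extensional (B n)"
      using wn[OF n] by (auto simp: star_set_def PiE_iff)
    then show ?thesis
      using x[OF n] by (auto simp: restrict_def extensional_def)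
  qed
  ultimately show ?thesis
    using that by blast
qed

text \<open>Blocks before the one containing the first difference consist of earlier indices, so that block is
  the first in which the two points differ.\<close>

lemma isometry_blocks:
  "isometry_onto Z \<rho> blocks.Z blocks.\<rho> (\<lambda>x. \<lambda>n\<in>{1..}. restrict x (B n))"
  (is "isometry_onto _ _ _ _ ?f")
proof -
  have maps: "?f x \<in> blocks.Z" if "x \<in> Z" for x
    using restrict_in[OF block_sub that] by (auto simp: star_set_natLeq)
  have dist: "blocks.\<rho> (?f x) (?f y) = \<rho> x y" if xy: "x \<in> Z" "y \<in> Z" for x y
  proof (cases "x = y")
    case True
    then show ?thesis
      by (simp only: star_dist_self blocks.star_dist_self)
  next
    case False
    then obtain l where l: "l \<in> S" "x l \<noteq> y l" "\<rho> x y = d l (x l) (y l)"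
      "\<And>v. v \<in> S \<Longrightarrow> (v, l) \<in> r \<Longrightarrow> v \<noteq> l \<Longrightarrow> x v = y v"
      using first_difference[OF xy] by metis
    then have "l \<in> support S X"
      using single_point_factor[OF l(1)] star_set_coord xy by blast
    then obtain n where n: "1 \<le> n" "l \<in> B n"
      using block_cover by blast
    have "blocks.\<rho> (?f x) (?f y) = \<mu> n (?f x n) (?f y n)"
    proof (rule blocks.star_dist_eq[OF maps[OF xy(1)] maps[OF xy(2)]])
      show "n \<in> {1..}"
        using n by simp
      show "?f x n \<noteq> ?f y n"
        using n l(2) by (auto dest: fun_cong[of _ _ l])
      fix m assume m: "m \<in> {1..}" "(m, n) \<in> natLeq" "m \<noteq> n"
      then have "1 \<le> m" "m < n"
        by (auto simp: natLeq_def)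
      then have "x s = y s" if "s \<in> B m" for s
        using l(4)[of s] block_mono[of m n s l] block_sub[of m] n that by blast
      then show "?f x m = ?f y m"
        by (auto simp: restrict_def)
    qed
    also have "\<dots> = d l (x l) (y l)"
      using star_dist_restrict[OF block_sub[OF n(1)] xy n(2) l(2)] l(4) block_sub[OF n(1)] n(1)
      by auto
    finally show ?thesis
      using l by simp
  qed
  have inj: "inj_on ?f Z"
  proof (rule inj_onI)
    fix x y assume xy: "x \<in> Z" "y \<in> Z" and eq: "?f x = ?f y"
    have "\<rho> x y = 0"
      using dist[OF xy] eq by (simp only: blocks.star_dist_self)
    then show "x = y"
      using star_dist_zero[OF xy] by simp
  qed
  have surj: "w \<in> ?f ` Z" if w: "w \<in> blocks.Z" for w
  proof -
    obtain x where x: "x \<in> Z" "\<And>n. 1 \<le> n \<Longrightarrow> restrict x (B n) = w n"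
      using glue[OF w] by metis
    have "w \<in> extensional {1..}"
      using w by (auto simp: star_set_def PiE_iff)
    then have "?f x = w"
      using x(2) by (auto simp: restrict_def extensional_def fun_eq_iff)
    then show ?thesis
      using imageI[OF x(1), of ?f] by (simp only:)
  qed
  show ?thesis
    unfolding isometry_onto_def isometric_map_def bij_betw_def
    using maps dist inj surj by blast
qed

text \<open>A distance \<open>p < \<epsilon> / 2\<close> attained in the block \<open>n\<close> bounds all distances attained in later blocks
  by \<open>\<epsilon>\<close>.\<close>

lemma blocks_topology:
  assumes small: "\<And>\<epsilon>. \<epsilon> > 0 \<Longrightarrow> \<exists>n\<ge>1. \<exists>s\<in>B n. \<exists>p\<in>positive_distances (X s) (d s). p < \<epsilon>"
  shows "blocks.star.mtopology = product_topology (\<lambda>n. Metric_space.mtopology (W n) (\<mu> n)) {1..}"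
proof (rule blocks.mtopology_eq_product_topology)
  show "blocks.Z = PiE {1..} W"
    by (rule star_set_natLeq)
  fix \<epsilon> :: real assume "\<epsilon> > 0"
  then obtain n s p where n: "1 \<le> n" and s: "s \<in> B n"
    and p: "p \<in> positive_distances (X s) (d s)" "p < \<epsilon> / 2"
    using small half_gt_zero by metis
  interpret sub: metric_star_product r "B n" X d "restrict a (B n)"
    by (rule block_product[OF n])
  have p_block: "p \<in> positive_distances (W n) (\<mu> n)"
    using p(1) sub.isometric_fun_upd[OF s]
    unfolding positive_distances_def isometric_map_def by (auto simp: Pi_iff) metis
  have "q < \<epsilon>" if m: "m \<in> {1..} - {1..n}" and q: "q \<in> positive_distances (W m) (\<mu> m)" for m q
  proof -
    have "q \<le> 2 * p"
      using m n by (intro blocks.spreadD[OF _ _ _ _ p_block q]) (auto simp: natLeq_def)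
    then show ?thesis
      using p(2) by simp
  qed
  then show "\<exists>F\<subseteq>{1..}. finite F \<and>
      (\<forall>m\<in>{1..} - F. \<forall>q\<in>positive_distances (W m) (\<mu> m). q < \<epsilon>)"
    by (intro exI[of _ "{1..n}"]) auto
qed

end

section \<open>Products without a last factor\<close>

context metric_star_product
begin

definition vanishing_sequence :: "(nat \<Rightarrow> 's) \<Rightarrow> bool"
  where "vanishing_sequence t \<longleftrightarrow>
    t ` {1..} \<subseteq> support S X \<and>
    (\<forall>m\<ge>1. \<forall>n>m. (t m, t n) \<in> r \<and> t m \<noteq> t n) \<and>
    \<not> bounded_above_in r (support S X) (t ` {1..}) \<and>
    (\<forall>\<epsilon>>0. \<exists>n\<ge>1. \<exists>c\<in>positive_distances (X (t n)) (d (t n)). c < \<epsilon>)"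

lemma later_support:
  assumes "\<nexists>g. is_greatest r (support S X) g" and u: "u \<in> support S X"
  obtains v where "v \<in> support S X" "(u, v) \<in> r" "u \<noteq> v"
proof -
  obtain v where v: "v \<in> support S X" "(v, u) \<notin> r"
    using assms by (auto simp: is_greatest_def)
  have "u \<in> S" "v \<in> S"
    using u v by (auto simp: support_def)
  then show ?thesis
    using that v ord_total[of u v] by blast
qed

text \<open>Indices that attain smaller and smaller distances can be pushed upwards at the cost of a factor
  2, hence be made increasing.  They cannot stay below an index of the support, since half a
  distance attained beyond it would bound all their distances from below.\<close>

lemma uniform_or_vanishing:
  assumes ng: "\<nexists>g. is_greatest r (support S X) g"
  shows "(\<exists>c>0. \<forall>s\<in>S. \<forall>p\<in>positive_distances (X s) (d s). c \<le> p) \<or> (\<exists>t. vanishing_sequence t)"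
proof (rule disjCI)
  assume no_t: "\<nexists>t. vanishing_sequence t"
  let ?T = "support S X"
  show "\<exists>c>0. \<forall>s\<in>S. \<forall>p\<in>positive_distances (X s) (d s). c \<le> p"
  proof (rule ccontr)
    assume no_c: "\<not> ?thesis"
    have arb: "\<exists>s\<in>?T. \<exists>p\<in>positive_distances (X s) (d s). p < c" if "c > 0" for c
      using no_c that support_iff by (metis empty_iff not_le)
    define P where "P n s \<longleftrightarrow> s \<in> ?T \<and> (\<exists>p\<in>positive_distances (X s) (d s). p < 1 / real (Suc n))" for n s
    have "\<exists>t. \<forall>n. P n (t n) \<and> ((t n, t (Suc n)) \<in> r \<and> t n \<noteq> t (Suc n))"
    proof (rule dependent_nat_choice)
      show "\<exists>s. P 0 s"
        using arb[of 1] by (auto simp: P_def)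
      fix s n assume "P n s"
      then have s: "s \<in> ?T"
        by (simp add: P_def)
      define \<delta> where "\<delta> = 1 / real (Suc (Suc n))"
      have "\<delta> / 2 > 0"
        by (simp add: \<delta>_def)
      then obtain u p where u: "u \<in> ?T" and p: "p \<in> positive_distances (X u) (d u)"
        "p < \<delta> / 2"
        using arb by meson
      have su: "s \<in> S" "u \<in> S"
        using s u by (auto simp: support_def)
      obtain m where m: "m \<in> ?T" "(s, m) \<in> r" "(u, m) \<in> r"
        using ord_total[OF su] ord_refl[OF su(1)] ord_refl[OF su(2)] s u by blast
      obtain v where v: "v \<in> ?T" "(m, v) \<in> r" "m \<noteq> v"
        using later_support[OF ng m(1)] by blast
      have mv: "m \<in> S" "v \<in> S"
        using m v by (auto simp: support_def)
      have sv: "(s, v) \<in> r" "(u, v) \<in> r"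
        using ord_trans[OF m(2) v(2)] ord_trans[OF m(3) v(2)] su mv by blast+
      have "s \<noteq> v" "u \<noteq> v"
        using ord_antisym m(2,3) v mv by blast+
      obtain q where q: "q \<in> positive_distances (X v) (d v)"
        using v support_iff by blast
      have "q \<le> 2 * p"
        using spreadD[OF su(2) mv(2) \<open>u \<noteq> v\<close> sv(2) p(1) q] .
      then have "q < \<delta>"
        using p(2) by linarith
      then have "P (Suc n) v"
        using q v(1) unfolding P_def \<delta>_def by blast
      then show "\<exists>v. P (Suc n) v \<and> (s, v) \<in> r \<and> s \<noteq> v"
        using sv \<open>s \<noteq> v\<close> by blast
    qed
    then obtain t where t: "\<And>n. P n (t n)" "\<And>n. (t n, t (Suc n)) \<in> r" "\<And>n. t n \<noteq> t (Suc n)"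
      by blast
    have tT: "t n \<in> ?T" and tS: "t n \<in> S" for n
      using t(1)[of n] by (auto simp: P_def support_def)
    have incr: "(t m, t (Suc (m + k))) \<in> r \<and> t m \<noteq> t (Suc (m + k))" for m k
    proof (induction k)
      case (Suc k)
      have "(t m, t (Suc (Suc (m + k)))) \<in> r"
        using ord_trans[OF _ t(2) tS tS tS] Suc by blast
      moreover have "t m \<noteq> t (Suc (Suc (m + k)))"
        using ord_antisym[OF _ _ tS tS, of m "Suc (m + k)"] Suc t(2)[of "Suc (m + k)"] by metis
      ultimately show ?case
        by simp
    qed (use t in simp)
    have strict: "(t m, t n) \<in> r \<and> t m \<noteq> t n" if "m < n" for m n
      using incr less_imp_Suc_add[OF that] by auto
    have small: "\<exists>n\<ge>1. \<exists>p\<in>positive_distances (X (t n)) (d (t n)). p < \<epsilon>" if "\<epsilon> > 0" for \<epsilon>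
    proof -
      obtain n where n: "1 / real (Suc n) < \<epsilon>"
        using \<open>\<epsilon> > 0\<close> nat_approx_posE by blast
      have le: "1 / real (Suc (Suc n)) \<le> 1 / real (Suc n)"
        by (simp add: frac_le)
      obtain p where "p \<in> positive_distances (X (t (Suc n))) (d (t (Suc n)))"
        "p < 1 / real (Suc (Suc n))"
        using t(1)[of "Suc n"] by (auto simp: P_def)
      then show ?thesis
        using n le by (intro exI[of _ "Suc n"]) (auto intro!: bexI[of _ p])
    qed
    have "\<not> bounded_above_in r ?T (t ` {1..})"
    proof
      assume "bounded_above_in r ?T (t ` {1..})"
      then obtain u where u: "u \<in> ?T" "\<And>n. 1 \<le> n \<Longrightarrow> (t n, u) \<in> r"
        by (auto simp: bounded_above_in_def)
      obtain v where v: "v \<in> ?T" "(u, v) \<in> r" "u \<noteq> v"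
        using later_support[OF ng u(1)] by blast
      have uv: "u \<in> S" "v \<in> S"
        using u v by (auto simp: support_def)
      obtain q where q: "q \<in> positive_distances (X v) (d v)"
        using v support_iff by blast
      have "q / 2 > 0"
        using q by (simp add: positive_distances_def)
      then obtain n p where n: "1 \<le> n" and p: "p \<in> positive_distances (X (t n)) (d (t n))" "p < q / 2"
        using small by blast
      have "(t n, v) \<in> r" "t n \<noteq> v"
        using ord_trans[OF u(2)[OF n] v(2) tS uv] ord_antisym[OF u(2)[OF n] _ tS uv(1)] v by auto
      then have "q \<le> 2 * p"
        using spreadD[OF tS uv(2) _ _ p(1) q] by blast
      then show False
        using p(2) by simp
    qed
    then have "vanishing_sequence t"
      using tT strict small by (auto simp: vanishing_sequence_def)
    then show False
      using no_t by blast
  qed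
qed

lemma uniform_or_vanishing_discrete:
  assumes "\<nexists>g. is_greatest r (support S X) g" "\<nexists>t. vanishing_sequence t"
  shows "complete_metric Z \<rho>" "topologically_discrete Z \<rho>"
  using uniform_or_vanishing[OF assms(1)] assms(2) uniformly_discrete_star by metis+

text \<open>Changing \<open>a\<close> at one late coordinate gives points arbitrarily close to \<open>a\<close>.\<close>

lemma vanishing_not_discrete:
  assumes t: "vanishing_sequence t"
  shows "\<not> topologically_discrete Z \<rho>"
proof
  assume "topologically_discrete Z \<rho>"
  then have "openin star.mtopology {a}"
    using base_in by (simp add: topologically_discrete_def)
  then obtain \<epsilon> where \<epsilon>: "\<epsilon> > 0" "star.mball a \<epsilon> \<subseteq> {a}"
    by (auto simp: star.openin_mtopology)
  have "\<epsilon> / 2 > 0"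
    using \<epsilon> by simp
  then obtain n c where n: "1 \<le> n" and c: "c \<in> positive_distances (X (t n)) (d (t n))" "c < \<epsilon> / 2"
    using t unfolding vanishing_sequence_def by blast
  have tT: "t n \<in> support S X" "t (Suc n) \<in> support S X"
    using t n by (auto simp: vanishing_sequence_def)
  then have tS: "t n \<in> S" "t (Suc n) \<in> S"
    by (auto simp: support_def)
  have tt: "(t n, t (Suc n)) \<in> r" "t n \<noteq> t (Suc n)"
    using t n by (auto simp: vanishing_sequence_def)
  obtain w where w: "w \<in> X (t (Suc n))" "w \<noteq> a (t (Suc n))"
    using tT(2) by (auto simp: support_def)
  let ?y = "a(t (Suc n) := w)"
  have y: "?y \<in> Z"
    using fun_upd_in[OF base_in tS(2) w(1)] .
  have "\<rho> a ?y \<le> 2 * c"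
  proof (rule dist_le_of_agree[OF base_in y tS(1) c(1)])
    fix u assume "u \<in> S" "(u, t n) \<in> r"
    then show "a u = ?y u"
      using ord_antisym[OF tt(1) _ tS] tt(2) by auto
  qed
  then have "?y \<in> star.mball a \<epsilon>"
    using base_in y c(2) by simp
  then have "?y = a"
    using \<epsilon>(2) by blast
  then show False
    using w(2) by (metis fun_upd_same)
qed

text \<open>An index of the support is not an upper bound of the sequence, so it lies below some \<open>t n\<close>; the
  least such \<open>n\<close> is the number of its block.\<close>

lemma blocked_product_vanishing:
  assumes t: "vanishing_sequence t"
  shows "blocked_product r S X d a (block r S t)"
proof
  have tT: "t n \<in> support S X" and tS: "t n \<in> S" if "1 \<le> n" for n
    using t that by (auto simp: vanishing_sequence_def support_def)
  have incr: "(t m, t n) \<in> r \<and> t m \<noteq> t n" if "1 \<le> m" "m < n" for m n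
    using t that by (auto simp: vanishing_sequence_def)
  show "block r S t n \<subseteq> S" for n
    by (auto simp: block_def)
  have upper: "(s, t n) \<in> r" if "1 \<le> n" "s \<in> block r S t n" for s n
    using that by (auto simp: block_def split: if_splits)
  show "(s, u) \<in> r \<and> s \<noteq> u"
    if mn: "1 \<le> m" "m < n" and s: "s \<in> block r S t m" and u: "u \<in> block r S t n" for m n s u
  proof -
    have su: "s \<in> S" "u \<in> S"
      using s u by (auto simp: block_def split: if_splits)
    let ?v = "t (n - 1)"
    have v: "(?v, u) \<in> r" "?v \<noteq> u" "?v \<in> S"
      using u mn tS[of "n - 1"] by (auto simp: block_def split: if_splits)
    have "(t m, ?v) \<in> r"
    proof (cases "m = n - 1")
      case True
      then show ?thesis
        using ord_refl v(3) by simp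
    next
      case False
      then show ?thesis
        using incr[OF mn(1), of "n - 1"] mn by simp
    qed
    then have "(s, ?v) \<in> r"
      using ord_trans[OF upper[OF mn(1) s] _ su(1) tS[OF mn(1)] v(3)] by blast
    then show ?thesis
      using ord_trans[OF _ v(1) su(1) v(3) su(2)] ord_antisym[OF _ v(1) ] v su by blast
  qed
  show "\<exists>n\<ge>1. s \<in> block r S t n" if s: "s \<in> support S X" for s
  proof -
    have sS: "s \<in> S"
      using s by (simp add: support_def)
    have ex: "\<exists>n. 1 \<le> n \<and> (s, t n) \<in> r"
      using t s ord_total[OF sS tS] unfolding vanishing_sequence_def bounded_above_in_def
      by (metis atLeast_iff imageE)
    define n where "n = (LEAST n. 1 \<le> n \<and> (s, t n) \<in> r)"
    have n: "1 \<le> n" "(s, t n) \<in> r"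
      using LeastI_ex[OF ex] unfolding n_def by blast+
    have "s \<in> block r S t n"
    proof (cases "n = 1")
      case True
      then show ?thesis
        using n sS by (simp add: block_def)
    next
      case False
      then have n1: "1 \<le> n - 1"
        using n by simp
      then have "(s, t (n - 1)) \<notin> r"
        using not_less_Least[of "n - 1" "\<lambda>n. 1 \<le> n \<and> (s, t n) \<in> r"] n unfolding n_def[symmetric]
        by auto
      then have "(t (n - 1), s) \<in> r" "s \<noteq> t (n - 1)"
        using ord_total[OF sS tS[OF n1]] ord_refl[OF sS] by auto
      then show ?thesis
        using False n sS by (simp add: block_def)
    qed
    then show ?thesis
      using n by blast
  qed
qed

text \<open>All indices of the block precede \<open>t (Suc n)\<close>, which belongs to the support.\<close>

lemma block_discrete:
  assumes t: "vanishing_sequence t" and n: "1 \<le> n"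
  defines "B \<equiv> block r S t n"
  shows "complete_metric (star_set r B X (restrict a B)) (star_dist r B X d (restrict a B))"
    "topologically_discrete (star_set r B X (restrict a B)) (star_dist r B X d (restrict a B))"
proof -
  have tT: "t n \<in> support S X" "t (Suc n) \<in> support S X"
    using t n by (auto simp: vanishing_sequence_def)
  then have tS: "t n \<in> S" "t (Suc n) \<in> S"
    by (auto simp: support_def)
  have tt: "(t n, t (Suc n)) \<in> r" "t n \<noteq> t (Suc n)"
    using t n by (auto simp: vanishing_sequence_def)
  have B: "B \<subseteq> S"
    by (auto simp: B_def block_def)
  have below: "(s, t (Suc n)) \<in> r \<and> s \<noteq> t (Suc n)" if "s \<in> B" for s
  proof -
    have s: "s \<in> S" "(s, t n) \<in> r"
      using that n by (auto simp: B_def block_def split: if_splits)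
    then show ?thesis
      using ord_trans[OF s(2) tt(1) s(1) tS] ord_antisym[OF tt(1) _ tS] tt(2) by auto
  qed
  show "complete_metric (star_set r B X (restrict a B)) (star_dist r B X d (restrict a B))"
    by (rule sub_product_discrete[OF B tT(2) below])
  show "topologically_discrete (star_set r B X (restrict a B)) (star_dist r B X d (restrict a B))"
    by (rule sub_product_discrete[OF B tT(2) below])
qed

lemma vanishing_block_distances:
  assumes t: "vanishing_sequence t" and \<epsilon>: "\<epsilon> > 0"
  shows "\<exists>n\<ge>1. \<exists>s\<in>block r S t n. \<exists>p\<in>positive_distances (X s) (d s). p < \<epsilon>"
proof -
  obtain n p where n: "1 \<le> n" and p: "p \<in> positive_distances (X (t n)) (d (t n))" "p < \<epsilon>"
    using t \<epsilon> unfolding vanishing_sequence_def by blast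
  have tS: "t m \<in> S" if "1 \<le> m" for m
    using t that by (auto simp: vanishing_sequence_def support_def)
  have "t n \<in> block r S t n"
  proof (cases "n = 1")
    case True
    then show ?thesis
      using tS ord_refl by (simp add: block_def)
  next
    case False
    then have "1 \<le> n - 1" "n - 1 < n"
      using n by simp_all
    then have "(t (n - 1), t n) \<in> r \<and> t (n - 1) \<noteq> t n"
      using t unfolding vanishing_sequence_def by blast
    then show ?thesis
      using False n tS[OF n] ord_refl by (auto simp: block_def)
  qed
  then show ?thesis
    using n p by blast
qed

end

section \<open>Productable collections\<close>

lemma productable_imp_star_product:
  assumes "productable S X d" "linear_order_on S (Restr r S)" "a \<in> PiE S X"
  shows "star_product r S X d a"
  using assms by (intro star_product.intro) (auto simp: productable_def)

theorem proposition4p8: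
  shows
    \<comment> \<open>(A)\<close>
    "(\<forall>(S :: 's set) (X :: 's \<Rightarrow> 'a set) d r a.
        productable S X d \<and> (\<forall>s\<in>S. absolutely_homogeneous (X s) (d s)) \<and>
        linear_order_on S r \<and> a \<in> PiE S X \<longrightarrow>
        (Metric_space (star_set r S X a) (star_dist r S X d a) \<longleftrightarrow>
         (\<forall>s\<^sub>1\<in>S. \<forall>s\<^sub>2\<in>S. s\<^sub>1 \<noteq> s\<^sub>2 \<and> (s\<^sub>1, s\<^sub>2) \<in> r \<longrightarrow>
            (\<forall>p\<in>positive_distances (X s\<^sub>1) (d s\<^sub>1). \<forall>q\<in>positive_distances (X s\<^sub>2) (d s\<^sub>2).
               q \<le> 2 * p))))
    \<and>
    \<comment> \<open>(B)\<close>
     (\<forall>(S :: 's set) (X :: 's \<Rightarrow> 'a set) d r a.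
        productable S X d \<and> (\<forall>s\<in>S. absolutely_homogeneous (X s) (d s)) \<and>
        linear_order_on S r \<and> a \<in> PiE S X \<and>
        (infinite (support S X) \<or> card (support S X) > 1) \<and>
        Metric_space (star_set r S X a) (star_dist r S X d a) \<longrightarrow>
        (let Z = star_set r S X a; \<rho> = star_dist r S X d a; T = support S X in
          \<comment> \<open>(a)\<close>
          (\<forall>U. openin (subtopology
                   (product_topology (\<lambda>s. Metric_space.mtopology (X s) (d s)) S) Z) U \<longrightarrow>
               openin (Metric_space.mtopology Z \<rho>) U) \<and>
          \<comment> \<open>(b)\<close>
          (\<forall>s\<in>S. isometric_map (X s) (d s) Z \<rho> (\<lambda>v. a(s := v)) \<and>
               closedin (Metric_space.mtopology Z \<rho>) ((\<lambda>v. a(s := v)) ` X s)) \<and>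
          \<comment> \<open>(c)\<close>
          (\<forall>s\<in>S. \<not> is_greatest r T s \<longrightarrow>
               complete_metric (X s) (d s) \<and> topologically_discrete (X s) (d s)) \<and>
          \<comment> \<open>(d)\<close>
          (\<forall>s\<in>S. \<not> is_least r T s \<longrightarrow> Metric_space.mbounded (X s) (d s) (X s)) \<and>
          \<comment> \<open>(e)\<close>
          (\<forall>t. is_greatest r T t \<longrightarrow>
             (let a' = restrict a (S - {t});
                  Z' = star_set r (S - {t}) X a'; \<rho>' = star_dist r (S - {t}) X d a';
                  P = Z' \<times> X t; \<pi> = pair_star_dist \<rho>' (d t) in
               complete_metric Z' \<rho>' \<and> topologically_discrete Z' \<rho>' \<and>
               isometry_onto Z \<rho> P \<pi> (\<lambda>x. (restrict x (S - {t}), x t)) \<and>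
               Metric_space P \<pi> \<and>
               Metric_space.mtopology P \<pi> =
                 prod_topology (Metric_space.mtopology Z' \<rho>') (Metric_space.mtopology (X t) (d t)) \<and>
               (complete_metric Z \<rho> \<longleftrightarrow> complete_metric (X t) (d t)))) \<and>
          \<comment> \<open>(f)\<close>
          ((\<nexists>g. is_greatest r T g) \<and> (\<forall>C. C \<subseteq> T \<and> countable C \<longrightarrow> bounded_above_in r T C) \<longrightarrow>
               complete_metric Z \<rho> \<and> topologically_discrete Z \<rho>) \<and>
          ((\<exists>\<epsilon>>0. \<forall>s\<in>S. \<forall>x\<in>X s. \<forall>y\<in>X s. d s x y \<in> {0} \<union> {\<epsilon>..}) \<longrightarrow>
               complete_metric Z \<rho> \<and> topologically_discrete Z \<rho>) \<and>
          \<comment> \<open>(g)\<close>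
          ((\<nexists>g. is_greatest r T g) \<longrightarrow>
             (let good = (\<lambda>t :: nat \<Rightarrow> 's.
                    t ` {1..} \<subseteq> T \<and>
                    (\<forall>m\<ge>1. \<forall>n>m. (t m, t n) \<in> r \<and> t m \<noteq> t n) \<and>
                    \<not> bounded_above_in r T (t ` {1..}) \<and>
                    (\<forall>\<epsilon>>0. \<exists>n\<ge>1. \<exists>c\<in>positive_distances (X (t n)) (d (t n)). c < \<epsilon>)) in
               (\<not> topologically_discrete Z \<rho> \<longleftrightarrow> (\<exists>t. good t)) \<and>
               (\<forall>t. good t \<longrightarrow>
                 (let Sn = block r S t;
                      an = (\<lambda>n. restrict a (Sn n));
                      W = (\<lambda>n. star_set r (Sn n) X (an n));
                      \<mu> = (\<lambda>n. star_dist r (Sn n) X d (an n));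
                      b = restrict an {1..};
                      P = star_set natLeq {1..} W b;
                      \<pi> = star_dist natLeq {1..} W \<mu> b in
                   (\<forall>n\<ge>1. complete_metric (W n) (\<mu> n) \<and> topologically_discrete (W n) (\<mu> n)) \<and>
                   isometry_onto Z \<rho> P \<pi> (\<lambda>x. \<lambda>n\<in>{1..}. restrict x (Sn n)) \<and>
                   Metric_space P \<pi> \<and>
                   Metric_space.mtopology P \<pi> =
                     product_topology (\<lambda>n. Metric_space.mtopology (W n) (\<mu> n)) {1..} \<and>
                   complete_metric Z \<rho>)))) \<and>
          \<comment> \<open>final equivalence of (B)\<close>
          (complete_metric Z \<rho> \<longleftrightarrow> (\<forall>s\<in>S. complete_metric (X s) (d s)))))
    \<and>
    \<comment> \<open>(C)\<close>
     (\<forall>(n :: nat) (X :: nat \<Rightarrow> 'b set) d a.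
        productable {1..n} X d \<and> (\<forall>k\<in>{1..n}. absolutely_homogeneous (X k) (d k)) \<and>
        a \<in> PiE {1..n} X \<and>
        Metric_space (star_set natLeq {1..n} X a) (star_dist natLeq {1..n} X d a) \<longrightarrow>
        Metric_space.mtopology (star_set natLeq {1..n} X a) (star_dist natLeq {1..n} X d a) =
          product_topology (\<lambda>k. Metric_space.mtopology (X k) (d k)) {1..n})"
proof (intro conjI allI impI, goal_cases)
  case (1 S X d r a)
  moreover from this have "Restr r S = r"
    unfolding order_on_defs by blast
  ultimately interpret star_product r S X d a
    by (intro productable_imp_star_product) auto
  show ?case
    using metric_iff_spread unfolding spread_def .
next
  case (2 S X d r a)
  moreover from this have "Restr r S = r"
    unfolding order_on_defs by blast
  ultimately interpret star_product r S X d a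
    by (intro productable_imp_star_product) auto
  have spread
    using 2 metric_imp_spread by blast
  then interpret metric_star_product r S X d a
    by unfold_locales
  have discrete_case: "complete_metric Z \<rho> \<and> topologically_discrete Z \<rho>"
    if "\<nexists>g. is_greatest r (support S X) g"
      and bounded: "\<forall>C. C \<subseteq> support S X \<and> countable C \<longrightarrow> bounded_above_in r (support S X) C"
  proof -
    have "countable (t ` {1..})" for t :: "nat \<Rightarrow> 's"
      by simp
    then have "\<nexists>t. vanishing_sequence t"
      using bounded unfolding vanishing_sequence_def by blast
    then show ?thesis
      using uniform_or_vanishing_discrete that(1) by blast
  qed
  have separated_case: "complete_metric Z \<rho> \<and> topologically_discrete Z \<rho>"
    if sep: "\<exists>\<epsilon>>0. \<forall>s\<in>S. \<forall>x\<in>X s. \<forall>y\<in>X s. d s x y \<in> {0} \<union> {\<epsilon>..}"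
  proof -
    obtain \<epsilon> where \<epsilon>: "\<epsilon> > 0"
      "\<And>s x y. s \<in> S \<Longrightarrow> x \<in> X s \<Longrightarrow> y \<in> X s \<Longrightarrow> d s x y \<in> {0} \<union> {\<epsilon>..}"
      using sep by blast
    have "\<epsilon> \<le> p" if "s \<in> S" "p \<in> positive_distances (X s) (d s)" for s p
      using that \<epsilon>(2) unfolding positive_distances_def by fastforce
    then show ?thesis
      using uniformly_discrete_star[OF \<epsilon>(1)] by blast
  qed
  have ng_complete: "complete_metric Z \<rho>" if "\<nexists>g. is_greatest r (support S X) g"
    using complete_star factor_discrete(1) that by blast
  have last_complete: "complete_metric Z \<rho> \<longleftrightarrow> complete_metric (X t) (d t)"
    if t: "is_greatest r (support S X) t" for t
  proof -
    have "t \<in> S"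
      using t by (simp add: is_greatest_def support_def)
    moreover have "complete_metric (X s) (d s)" if "s \<in> S" "s \<noteq> t" for s
      using factor_discrete(1)[OF that(1)] greatest_unique[OF t] that(2) by blast
    ultimately show ?thesis
      unfolding complete_star_iff by blast
  qed
  have nondiscrete_iff: "\<not> topologically_discrete Z \<rho> \<longleftrightarrow> (\<exists>t. vanishing_sequence t)"
    if "\<nexists>g. is_greatest r (support S X) g"
    using vanishing_not_discrete uniform_or_vanishing_discrete(2)[OF that] by blast
  have blocks:
    "isometry_onto Z \<rho>
      (star_set natLeq {1..} (\<lambda>n. star_set r (block r S t n) X (restrict a (block r S t n)))
        (restrict (\<lambda>n. restrict a (block r S t n)) {1..}))
      (star_dist natLeq {1..} (\<lambda>n. star_set r (block r S t n) X (restrict a (block r S t n)))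
        (\<lambda>n. star_dist r (block r S t n) X d (restrict a (block r S t n)))
        (restrict (\<lambda>n. restrict a (block r S t n)) {1..}))
      (\<lambda>x. \<lambda>n\<in>{1..}. restrict x (block r S t n))"
    "Metric_space
      (star_set natLeq {1..} (\<lambda>n. star_set r (block r S t n) X (restrict a (block r S t n)))
        (restrict (\<lambda>n. restrict a (block r S t n)) {1..}))
      (star_dist natLeq {1..} (\<lambda>n. star_set r (block r S t n) X (restrict a (block r S t n)))
        (\<lambda>n. star_dist r (block r S t n) X d (restrict a (block r S t n)))
        (restrict (\<lambda>n. restrict a (block r S t n)) {1..}))"
    "Metric_space.mtopology
      (star_set natLeq {1..} (\<lambda>n. star_set r (block r S t n) X (restrict a (block r S t n)))
        (restrict (\<lambda>n. restrict a (block r S t n)) {1..}))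
      (star_dist natLeq {1..} (\<lambda>n. star_set r (block r S t n) X (restrict a (block r S t n)))
        (\<lambda>n. star_dist r (block r S t n) X d (restrict a (block r S t n)))
        (restrict (\<lambda>n. restrict a (block r S t n)) {1..})) =
      product_topology (\<lambda>n. Metric_space.mtopology
        (star_set r (block r S t n) X (restrict a (block r S t n)))
        (star_dist r (block r S t n) X d (restrict a (block r S t n)))) {1..}"
    if t: "vanishing_sequence t" for t
  proof -
    interpret blocked: blocked_product r S X d a "block r S t"
      by (rule blocked_product_vanishing[OF t])
    show "isometry_onto Z \<rho> blocked.blocks.Z blocked.blocks.\<rho>
        (\<lambda>x. \<lambda>n\<in>{1..}. restrict x (block r S t n))"
      by (rule blocked.isometry_blocks)
    show "Metric_space blocked.blocks.Z blocked.blocks.\<rho>"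
      by (rule blocked.blocks.star.Metric_space_axioms)
    show "blocked.blocks.star.mtopology =
        product_topology (\<lambda>n. Metric_space.mtopology (blocked.W n) (blocked.\<mu> n)) {1..}"
      using vanishing_block_distances[OF t] by (rule blocked.blocks_topology)
  qed
  show ?case
    unfolding Let_def vanishing_sequence_def[symmetric]
  proof (intro conjI allI ballI impI, goal_cases)
    case (1 U)
    then show ?case by (rule finer_than_product)
  next
    case (2 s)
    then show ?case by (rule isometric_fun_upd)
  next
    case (3 s)
    then show ?case by (rule closedin_fun_upd_image)
  next
    case (4 s)
    then show ?case by (rule factor_discrete)
  next
    case (5 s)
    then show ?case by (rule factor_discrete)
  next
    case (6 s)
    then show ?case by (rule factor_bounded)
  next
    case (7 t)
    then show ?case by (rule split_last)
  next
    case (8 t)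
    then show ?case by (rule split_last)
  next
    case (9 t)
    then show ?case by (rule isometry_split_last)
  next
    case (10 t)
    then show ?case by (rule split_last)
  next
    case (11 t)
    then show ?case by (rule split_last)
  next
    case (12 t)
    then show ?case by (rule last_complete)
  next
    case 13
    then show ?case using discrete_case by blast
  next
    case 14
    then show ?case using discrete_case by blast
  next
    case 15
    then show ?case using separated_case by blast
  next
    case 16
    then show ?case using separated_case by blast
  next
    case 17
    then show ?case by (rule nondiscrete_iff)
  next
    case (18 t n)
    then show ?case by (intro block_discrete)
  next
    case (19 t n)
    then show ?case by (intro block_discrete)
  next
    case (20 t)
    then show ?case by (intro blocks)
  next
    case (21 t)
    then show ?case by (intro blocks)
  next
    case (22 t)
    then show ?case by (intro blocks)
  next
    case (23 t)
    then show ?case by (intro ng_complete)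
  next
    case 24
    then show ?case by (rule complete_star_iff)
  qed
next
  case (3 n X d a)
  then interpret star_product natLeq "{1..n}" X d a
    by (intro productable_imp_star_product) (auto simp: linear_order_on_natLeq)
  have spread
    using 3 metric_imp_spread by blast
  then interpret metric_star_product natLeq "{1..n}" X d a
    by unfold_locales
  show ?case
    by (rule mtopology_eq_product_topology[OF star_set_natLeq]) (auto intro: exI[of _ "{1..n}"])
qed

end
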